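(* Let $k$ be a field and let $\mathcal{C}$ be an essentially small $k$-linear Hom-finite triangulated category with split idempotents and suspension functor $\Sigma$. Let $w \geqslant 2$ be an integer and let $\mathcal{S}$ be a $w$-orthogonal collection in $\mathcal{C}$. Then the extension closure $\langle \mathcal{S} \rangle \subseteq \mathcal{C}$ is a proper abelian subcategory where each object has finite length, and the simple objects of $\langle \mathcal{S} \rangle$ are, up to isomorphism, precisely the objects in $\mathcal{S}$.
   Context: $\mathcal{C}(x,y)$ denotes the Hom space in $\mathcal{C}$. A $w$-orthogonal collection in $\mathcal{C}$ ($w$ a positive integer) is a finite set $\mathcal{S} = \{ s_1, \ldots, s_e \}$ of objects of $\mathcal{C}$ such that: (i) $\mathcal{C}(s_i,s_j)$ is a skew field if $i=j$ and is $0$ if $i \neq j$; (ii) $\mathcal{C}(s_i,\Sigma^{\ell}s_j) = 0$ for all $i,j$ and all $\ell \in \{ -w+1, \ldots, -1 \}$. An additive subcategory is a full subcategory closed under isomorphisms, direct sums, and direct summands. A diagram $c' \to c \to c''$ in $\mathcal{C}$ is a short triangle if it can be completed to a (distinguished) triangle $c' \to c \to c'' \to \Sigma c'$. An additive subcategory $\mathcal{A} \subseteq \mathcal{C}$ is a proper abelian subcategory if $\mathcal{A}$ is an abelian category whose short exact sequences are precisely the short triangles in $\mathcal{C}$ with terms in $\mathcal{A}$. For full subcategories $\mathcal{A},\mathcal{B} \subseteq \mathcal{C}$, $\mathcal{A} * \mathcal{B}$ is the full subcategory of objects $e$ for which there is a short triangle $a \to e \to b$ with $a \in \mathcal{A}$,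 $b \in \mathcal{B}$. The extension closure of $\mathcal{S}$ is $\langle \mathcal{S} \rangle = \bigcup_{n \geqslant 0} (\mathcal{S})_n$, where $(\mathcal{S})_0 = \{0\}$ and $(\mathcal{S})_n = (\mathcal{S})_{n-1} * (\mathcal{S} \cup \{0\})$ for $n \geqslant 1$; it is the smallest full subcategory closed under isomorphisms, direct sums and extensions that contains $\mathcal{S}$. *)

theory Defs
  imports "HOL-Algebra.Module"
begin

section \<open>Categories enriched in abelian groups and in vector spaces\<close>

text \<open>
  The objects and the morphisms of a category are sets in the sense of HOL, so a category is small
  here, and essential smallness does not appear as a separate assumption.
  Hom-sets of different pairs of objects are not required to be disjoint.
  A morphism space is a record of type \<open>module\<close>; its components \<open>mult\<close> and \<open>one\<close> are never used.
\<close>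

record ('o, 'k, 'm) cat =
  Obj :: "'o set"
  Hom :: "'o \<Rightarrow> 'o \<Rightarrow> ('k, 'm) module"
  Comp :: "'m \<Rightarrow> 'm \<Rightarrow> 'm"  (infixr \<open>\<cdot>\<index>\<close> 70)
  Ident :: "'o \<Rightarrow> 'm"

abbreviation mor :: "('o, 'k, 'm) cat \<Rightarrow> 'o \<Rightarrow> 'o \<Rightarrow> 'm set" where
  "mor C x y \<equiv> carrier (Hom C x y)"

locale category =
  fixes C :: "('o, 'k, 'm) cat" (structure)
  assumes ident_closed: "x \<in> Obj C \<Longrightarrow> Ident C x \<in> mor C x x"
    and comp_closed:
      "\<lbrakk>x \<in> Obj C; y \<in> Obj C; z \<in> Obj C; f \<in> mor C x y; g \<in> mor C y z\<rbrakk> \<Longrightarrow> g \<cdot> f \<in> mor C x z"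
    and comp_assoc:
      "\<lbrakk>x \<in> Obj C; y \<in> Obj C; z \<in> Obj C; t \<in> Obj C;
        f \<in> mor C x y; g \<in> mor C y z; h \<in> mor C z t\<rbrakk> \<Longrightarrow> (h \<cdot> g) \<cdot> f = h \<cdot> (g \<cdot> f)"
    and ident_left: "\<lbrakk>x \<in> Obj C; y \<in> Obj C; f \<in> mor C x y\<rbrakk> \<Longrightarrow> Ident C y \<cdot> f = f"
    and ident_right: "\<lbrakk>x \<in> Obj C; y \<in> Obj C; f \<in> mor C x y\<rbrakk> \<Longrightarrow> f \<cdot> Ident C x = f"

definition is_iso :: "('o, 'k, 'm) cat \<Rightarrow> 'o \<Rightarrow> 'o \<Rightarrow> 'm \<Rightarrow> bool" where
  "is_iso C x y f \<longleftrightarrow> x \<in> Obj C \<and> y \<in> Obj C \<and> f \<in> mor C x y \<and>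
     (\<exists>g\<in>mor C y x. g \<cdot>\<^bsub>C\<^esub> f = Ident C x \<and> f \<cdot>\<^bsub>C\<^esub> g = Ident C y)"

definition isomorphic :: "('o, 'k, 'm) cat \<Rightarrow> 'o \<Rightarrow> 'o \<Rightarrow> bool" where
  "isomorphic C x y \<longleftrightarrow> (\<exists>f. is_iso C x y f)"

definition is_mono :: "('o, 'k, 'm) cat \<Rightarrow> 'o \<Rightarrow> 'o \<Rightarrow> 'm \<Rightarrow> bool" where
  "is_mono C x y f \<longleftrightarrow> x \<in> Obj C \<and> y \<in> Obj C \<and> f \<in> mor C x y \<and>
     (\<forall>t\<in>Obj C. \<forall>g\<in>mor C t x. \<forall>h\<in>mor C t x. f \<cdot>\<^bsub>C\<^esub> g = f \<cdot>\<^bsub>C\<^esub> h \<longrightarrow> g = h)"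

definition is_epi :: "('o, 'k, 'm) cat \<Rightarrow> 'o \<Rightarrow> 'o \<Rightarrow> 'm \<Rightarrow> bool" where
  "is_epi C x y f \<longleftrightarrow> x \<in> Obj C \<and> y \<in> Obj C \<and> f \<in> mor C x y \<and>
     (\<forall>t\<in>Obj C. \<forall>g\<in>mor C y t. \<forall>h\<in>mor C y t. g \<cdot>\<^bsub>C\<^esub> f = h \<cdot>\<^bsub>C\<^esub> f \<longrightarrow> g = h)"

definition is_zero_object :: "('o, 'k, 'm) cat \<Rightarrow> 'o \<Rightarrow> bool" where
  "is_zero_object C z \<longleftrightarrow> z \<in> Obj C \<and>
     (\<forall>x\<in>Obj C. (\<exists>!f. f \<in> mor C x z) \<and> (\<exists>!f. f \<in> mor C z x))"

locale preadditive_category = category C for C :: "('o, 'k, 'm) cat" (structure) +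
  assumes hom_abelian_group: "\<lbrakk>x \<in> Obj C; y \<in> Obj C\<rbrakk> \<Longrightarrow> abelian_group (Hom C x y)"
    and comp_add_right:
      "\<lbrakk>x \<in> Obj C; y \<in> Obj C; z \<in> Obj C; f \<in> mor C x y; f' \<in> mor C x y; g \<in> mor C y z\<rbrakk>
       \<Longrightarrow> g \<cdot> (f \<oplus>\<^bsub>Hom C x y\<^esub> f') = (g \<cdot> f) \<oplus>\<^bsub>Hom C x z\<^esub> (g \<cdot> f')"
    and comp_add_left:
      "\<lbrakk>x \<in> Obj C; y \<in> Obj C; z \<in> Obj C; f \<in> mor C x y; g \<in> mor C y z; g' \<in> mor C y z\<rbrakk>
       \<Longrightarrow> (g \<oplus>\<^bsub>Hom C y z\<^esub> g') \<cdot> f = (g \<cdot> f) \<oplus>\<^bsub>Hom C x z\<^esub> (g' \<cdot> f)"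

definition is_direct_sum :: "('o, 'k, 'm) cat \<Rightarrow> 'o \<Rightarrow> 'o \<Rightarrow> 'o \<Rightarrow> bool" where
  "is_direct_sum C a b s \<longleftrightarrow> a \<in> Obj C \<and> b \<in> Obj C \<and> s \<in> Obj C \<and>
     (\<exists>i\<in>mor C a s. \<exists>j\<in>mor C b s. \<exists>p\<in>mor C s a. \<exists>q\<in>mor C s b.
        p \<cdot>\<^bsub>C\<^esub> i = Ident C a \<and> q \<cdot>\<^bsub>C\<^esub> j = Ident C b \<and>
        q \<cdot>\<^bsub>C\<^esub> i = \<zero>\<^bsub>Hom C a b\<^esub> \<and> p \<cdot>\<^bsub>C\<^esub> j = \<zero>\<^bsub>Hom C b a\<^esub> \<and>
        (i \<cdot>\<^bsub>C\<^esub> p) \<oplus>\<^bsub>Hom C s s\<^esub> (j \<cdot>\<^bsub>C\<^esub> q) = Ident C s)"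

locale additive_category = preadditive_category C for C :: "('o, 'k, 'm) cat" (structure) +
  assumes ex_zero_object: "\<exists>z. is_zero_object C z"
    and ex_direct_sum: "\<lbrakk>a \<in> Obj C; b \<in> Obj C\<rbrakk> \<Longrightarrow> \<exists>s. is_direct_sum C a b s"

locale linear_category = K: field K + preadditive_category C
  for K :: "'k ring" and C :: "('o, 'k, 'm) cat" (structure) +
  assumes hom_module: "\<lbrakk>x \<in> Obj C; y \<in> Obj C\<rbrakk> \<Longrightarrow> module K (Hom C x y)"
    and comp_smult_right:
      "\<lbrakk>x \<in> Obj C; y \<in> Obj C; z \<in> Obj C; f \<in> mor C x y; g \<in> mor C y z; c \<in> carrier K\<rbrakk>
       \<Longrightarrow> g \<cdot> (c \<odot>\<^bsub>Hom C x y\<^esub> f) = c \<odot>\<^bsub>Hom C x z\<^esub> (g \<cdot> f)"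
    and comp_smult_left:
      "\<lbrakk>x \<in> Obj C; y \<in> Obj C; z \<in> Obj C; f \<in> mor C x y; g \<in> mor C y z; c \<in> carrier K\<rbrakk>
       \<Longrightarrow> (c \<odot>\<^bsub>Hom C y z\<^esub> g) \<cdot> f = c \<odot>\<^bsub>Hom C x z\<^esub> (g \<cdot> f)"

definition finite_dimensional :: "'k ring \<Rightarrow> ('k, 'm) module \<Rightarrow> bool" where
  "finite_dimensional K V \<longleftrightarrow> (\<exists>B. finite B \<and> B \<subseteq> carrier V \<and>
     (\<forall>v\<in>carrier V. \<exists>c \<in> B \<rightarrow> carrier K. v = (\<Oplus>\<^bsub>V\<^esub>b\<in>B. c b \<odot>\<^bsub>V\<^esub> b)))"

definition hom_finite :: "'k ring \<Rightarrow> ('o, 'k, 'm) cat \<Rightarrow> bool" where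
  "hom_finite K C \<longleftrightarrow> (\<forall>x\<in>Obj C. \<forall>y\<in>Obj C. finite_dimensional K (Hom C x y))"

definition split_idempotents :: "('o, 'k, 'm) cat \<Rightarrow> bool" where
  "split_idempotents C \<longleftrightarrow>
     (\<forall>x\<in>Obj C. \<forall>e\<in>mor C x x. e \<cdot>\<^bsub>C\<^esub> e = e \<longrightarrow>
        (\<exists>y\<in>Obj C. \<exists>r\<in>mor C x y. \<exists>s\<in>mor C y x. s \<cdot>\<^bsub>C\<^esub> r = e \<and> r \<cdot>\<^bsub>C\<^esub> s = Ident C y))"


section \<open>Abelian categories, finite length and simple objects\<close>

definition is_kernel :: "('o, 'k, 'm) cat \<Rightarrow> 'o \<Rightarrow> 'o \<Rightarrow> 'm \<Rightarrow> 'o \<Rightarrow> 'm \<Rightarrow> bool" where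
  "is_kernel C x y f a i \<longleftrightarrow>
     x \<in> Obj C \<and> y \<in> Obj C \<and> a \<in> Obj C \<and> f \<in> mor C x y \<and> i \<in> mor C a x \<and>
     f \<cdot>\<^bsub>C\<^esub> i = \<zero>\<^bsub>Hom C a y\<^esub> \<and>
     (\<forall>t\<in>Obj C. \<forall>g\<in>mor C t x. f \<cdot>\<^bsub>C\<^esub> g = \<zero>\<^bsub>Hom C t y\<^esub> \<longrightarrow>
        (\<exists>!h. h \<in> mor C t a \<and> i \<cdot>\<^bsub>C\<^esub> h = g))"

definition is_cokernel :: "('o, 'k, 'm) cat \<Rightarrow> 'o \<Rightarrow> 'o \<Rightarrow> 'm \<Rightarrow> 'o \<Rightarrow> 'm \<Rightarrow> bool" where
  "is_cokernel C x y f b p \<longleftrightarrow>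
     x \<in> Obj C \<and> y \<in> Obj C \<and> b \<in> Obj C \<and> f \<in> mor C x y \<and> p \<in> mor C y b \<and>
     p \<cdot>\<^bsub>C\<^esub> f = \<zero>\<^bsub>Hom C x b\<^esub> \<and>
     (\<forall>t\<in>Obj C. \<forall>g\<in>mor C y t. g \<cdot>\<^bsub>C\<^esub> f = \<zero>\<^bsub>Hom C x t\<^esub> \<longrightarrow>
        (\<exists>!h. h \<in> mor C b t \<and> h \<cdot>\<^bsub>C\<^esub> p = g))"

locale abelian_category = additive_category C for C :: "('o, 'k, 'm) cat" (structure) +
  assumes ex_kernel:
      "\<lbrakk>x \<in> Obj C; y \<in> Obj C; f \<in> mor C x y\<rbrakk> \<Longrightarrow> \<exists>a i. is_kernel C x y f a i"
    and ex_cokernel: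
      "\<lbrakk>x \<in> Obj C; y \<in> Obj C; f \<in> mor C x y\<rbrakk> \<Longrightarrow> \<exists>b p. is_cokernel C x y f b p"
    and mono_is_kernel: "is_mono C x y f \<Longrightarrow> \<exists>z g. is_kernel C y z g x f"
    and epi_is_cokernel: "is_epi C x y f \<Longrightarrow> \<exists>z g. is_cokernel C z x g y f"

text \<open>The image of a morphism is the kernel of its cokernel.\<close>

definition is_image :: "('o, 'k, 'm) cat \<Rightarrow> 'o \<Rightarrow> 'o \<Rightarrow> 'm \<Rightarrow> 'o \<Rightarrow> 'm \<Rightarrow> bool" where
  "is_image C x y f a i \<longleftrightarrow> (\<exists>b p. is_cokernel C x y f b p \<and> is_kernel C y b p a i)"

definition short_exact :: "('o, 'k, 'm) cat \<Rightarrow> 'o \<Rightarrow> 'o \<Rightarrow> 'o \<Rightarrow> 'm \<Rightarrow> 'm \<Rightarrow> bool" where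
  "short_exact C x y z f g \<longleftrightarrow> is_mono C x y f \<and> is_epi C y z g \<and>
     (\<exists>a i. is_image C x y f a i \<and> is_kernel C y z g a i)"

definition is_simple :: "('o, 'k, 'm) cat \<Rightarrow> 'o \<Rightarrow> bool" where
  "is_simple C x \<longleftrightarrow> x \<in> Obj C \<and> \<not> is_zero_object C x \<and>
     (\<forall>y i. is_mono C y x i \<longrightarrow> is_zero_object C y \<or> is_iso C y x i)"

text \<open>An object has finite length if it has a composition series.\<close>

definition has_finite_length :: "('o, 'k, 'm) cat \<Rightarrow> 'o \<Rightarrow> bool" where
  "has_finite_length C x \<longleftrightarrow> (\<exists>(n::nat) X. is_zero_object C (X 0) \<and> X n = x \<and>
     (\<forall>j<n. \<exists>s f g. is_simple C s \<and> short_exact C (X j) (X (Suc j)) s f g))"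


section \<open>Triangulated categories\<close>

record ('o, 'm) endofun =
  omap :: "'o \<Rightarrow> 'o"
  amap :: "'m \<Rightarrow> 'm"

definition id_fun :: "('o, 'm) endofun" where
  "id_fun = \<lparr>omap = (\<lambda>x. x), amap = (\<lambda>f. f)\<rparr>"

definition comp_fun :: "('o, 'm) endofun \<Rightarrow> ('o, 'm) endofun \<Rightarrow> ('o, 'm) endofun" where
  "comp_fun G F = \<lparr>omap = omap G \<circ> omap F, amap = amap G \<circ> amap F\<rparr>"

locale endofunctor = category C
  for C :: "('o, 'k, 'm) cat" (structure) and F :: "('o, 'm) endofun" +
  assumes omap_closed: "x \<in> Obj C \<Longrightarrow> omap F x \<in> Obj C"
    and amap_closed:
      "\<lbrakk>x \<in> Obj C; y \<in> Obj C; f \<in> mor C x y\<rbrakk> \<Longrightarrow> amap F f \<in> mor C (omap F x) (omap F y)"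
    and amap_ident: "x \<in> Obj C \<Longrightarrow> amap F (Ident C x) = Ident C (omap F x)"
    and amap_comp:
      "\<lbrakk>x \<in> Obj C; y \<in> Obj C; z \<in> Obj C; f \<in> mor C x y; g \<in> mor C y z\<rbrakk>
       \<Longrightarrow> amap F (g \<cdot> f) = amap F g \<cdot> amap F f"

definition naturally_isomorphic ::
    "('o, 'k, 'm) cat \<Rightarrow> ('o, 'm) endofun \<Rightarrow> ('o, 'm) endofun \<Rightarrow> bool" where
  "naturally_isomorphic C F G \<longleftrightarrow> (\<exists>\<eta>.
     (\<forall>x\<in>Obj C. is_iso C (omap F x) (omap G x) (\<eta> x)) \<and>
     (\<forall>x\<in>Obj C. \<forall>y\<in>Obj C. \<forall>f\<in>mor C x y. amap G f \<cdot>\<^bsub>C\<^esub> \<eta> x = \<eta> y \<cdot>\<^bsub>C\<^esub> amap F f))"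

text \<open>
  The suspension \<open>Susp\<close> is an autoequivalence (not necessarily an automorphism) with quasi-inverse
  \<open>Desusp\<close>. The set \<open>Tri\<close> consists of the distinguished triangles; \<open>(x, y, z, u, v, w)\<close> stands for
  the diagram with maps \<open>u\<close> from \<open>x\<close> to \<open>y\<close>, \<open>v\<close> from \<open>y\<close> to \<open>z\<close> and \<open>w\<close> from \<open>z\<close> to \<open>omap Susp x\<close>.
\<close>

locale triangulated_category =
  linear_category K C + additive_category C + Susp: endofunctor C Susp + Desusp: endofunctor C Desusp
  for K :: "'k ring" and C :: "('o, 'k, 'm) cat" (structure)
    and Susp :: "('o, 'm) endofun" and Desusp :: "('o, 'm) endofun"
    and Tri :: "('o \<times> 'o \<times> 'o \<times> 'm \<times> 'm \<times> 'm) set" +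
  assumes Susp_add:
      "\<lbrakk>x \<in> Obj C; y \<in> Obj C; f \<in> mor C x y; g \<in> mor C x y\<rbrakk>
       \<Longrightarrow> amap Susp (f \<oplus>\<^bsub>Hom C x y\<^esub> g) =
           amap Susp f \<oplus>\<^bsub>Hom C (omap Susp x) (omap Susp y)\<^esub> amap Susp g"
    and Susp_smult:
      "\<lbrakk>x \<in> Obj C; y \<in> Obj C; f \<in> mor C x y; r \<in> carrier K\<rbrakk>
       \<Longrightarrow> amap Susp (r \<odot>\<^bsub>Hom C x y\<^esub> f) =
           r \<odot>\<^bsub>Hom C (omap Susp x) (omap Susp y)\<^esub> amap Susp f"
    and Desusp_Susp: "naturally_isomorphic C (comp_fun Desusp Susp) id_fun"
    and Susp_Desusp: "naturally_isomorphic C (comp_fun Susp Desusp) id_fun"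
    and Tri_closed:
      "(x, y, z, u, v, w) \<in> Tri \<Longrightarrow>
         x \<in> Obj C \<and> y \<in> Obj C \<and> z \<in> Obj C \<and>
         u \<in> mor C x y \<and> v \<in> mor C y z \<and> w \<in> mor C z (omap Susp x)"
    and Tri_iso:
      "\<lbrakk>(x, y, z, u, v, w) \<in> Tri; is_iso C x x' a; is_iso C y y' b; is_iso C z z' c;
        u' \<in> mor C x' y'; v' \<in> mor C y' z'; w' \<in> mor C z' (omap Susp x');
        b \<cdot> u = u' \<cdot> a; c \<cdot> v = v' \<cdot> b; amap Susp a \<cdot> w = w' \<cdot> c\<rbrakk>
       \<Longrightarrow> (x', y', z', u', v', w') \<in> Tri"
    and Tri_ident:
      "\<lbrakk>x \<in> Obj C; is_zero_object C z\<rbrakk>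
       \<Longrightarrow> (x, x, z, Ident C x, \<zero>\<^bsub>Hom C x z\<^esub>, \<zero>\<^bsub>Hom C z (omap Susp x)\<^esub>) \<in> Tri"
    and Tri_complete:
      "\<lbrakk>x \<in> Obj C; y \<in> Obj C; u \<in> mor C x y\<rbrakk> \<Longrightarrow> \<exists>z v w. (x, y, z, u, v, w) \<in> Tri"
    and Tri_rotate:
      "\<lbrakk>x \<in> Obj C; y \<in> Obj C; z \<in> Obj C;
        u \<in> mor C x y; v \<in> mor C y z; w \<in> mor C z (omap Susp x)\<rbrakk>
       \<Longrightarrow> (x, y, z, u, v, w) \<in> Tri \<longleftrightarrow>
           (y, z, omap Susp x, v, w, \<ominus>\<^bsub>Hom C (omap Susp x) (omap Susp y)\<^esub> amap Susp u) \<in> Tri"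
    and Tri_morphism:
      "\<lbrakk>(x, y, z, u, v, w) \<in> Tri; (x', y', z', u', v', w') \<in> Tri;
        a \<in> mor C x x'; b \<in> mor C y y'; b \<cdot> u = u' \<cdot> a\<rbrakk>
       \<Longrightarrow> \<exists>c\<in>mor C z z'. c \<cdot> v = v' \<cdot> b \<and> amap Susp a \<cdot> w = w' \<cdot> c"
    and Tri_octahedral:
      "\<lbrakk>(x, y, z', u, i, i') \<in> Tri; (y, z, x', v, j, j') \<in> Tri; (x, z, y', v \<cdot> u, l, l') \<in> Tri\<rbrakk>
       \<Longrightarrow> \<exists>f\<in>mor C z' y'. \<exists>g\<in>mor C y' x'.
             (z', y', x', f, g, amap Susp i \<cdot> j') \<in> Tri \<and>
             f \<cdot> i = l \<cdot> v \<and> l' \<cdot> f = i' \<and> g \<cdot> l = j \<and> j' \<cdot> g = amap Susp u \<cdot> l'"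

definition susp_power :: "('o, 'm) endofun \<Rightarrow> ('o, 'm) endofun \<Rightarrow> int \<Rightarrow> 'o \<Rightarrow> 'o" where
  "susp_power Susp Desusp l x =
     (if 0 \<le> l then (omap Susp ^^ nat l) x else (omap Desusp ^^ nat (- l)) x)"

definition short_triangle ::
    "('o \<times> 'o \<times> 'o \<times> 'm \<times> 'm \<times> 'm) set \<Rightarrow> 'o \<Rightarrow> 'o \<Rightarrow> 'o \<Rightarrow> 'm \<Rightarrow> 'm \<Rightarrow> bool" where
  "short_triangle Tri x y z f g \<longleftrightarrow> (\<exists>h. (x, y, z, f, g, h) \<in> Tri)"


section \<open>Proper abelian subcategories and orthogonal collections\<close>

text \<open>A full subcategory is given by its set of objects.\<close>

definition full_subcategory :: "('o, 'k, 'm) cat \<Rightarrow> 'o set \<Rightarrow> ('o, 'k, 'm) cat" where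
  "full_subcategory C A = C\<lparr>Obj := A\<rparr>"

text \<open>Closure under the empty direct sum means that the zero objects belong to \<open>A\<close>.\<close>

definition additive_subcategory :: "('o, 'k, 'm) cat \<Rightarrow> 'o set \<Rightarrow> bool" where
  "additive_subcategory C A \<longleftrightarrow> A \<subseteq> Obj C \<and>
     (\<forall>a b. a \<in> A \<longrightarrow> isomorphic C a b \<longrightarrow> b \<in> A) \<and>
     (\<forall>z. is_zero_object C z \<longrightarrow> z \<in> A) \<and>
     (\<forall>a b s. a \<in> A \<longrightarrow> b \<in> A \<longrightarrow> is_direct_sum C a b s \<longrightarrow> s \<in> A) \<and>
     (\<forall>a b s. s \<in> A \<longrightarrow> is_direct_sum C a b s \<longrightarrow> a \<in> A \<and> b \<in> A)"

definition proper_abelian_subcategory ::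
    "('o, 'k, 'm) cat \<Rightarrow> ('o \<times> 'o \<times> 'o \<times> 'm \<times> 'm \<times> 'm) set \<Rightarrow> 'o set \<Rightarrow> bool" where
  "proper_abelian_subcategory C Tri A \<longleftrightarrow>
     additive_subcategory C A \<and> abelian_category (full_subcategory C A) \<and>
     (\<forall>x\<in>A. \<forall>y\<in>A. \<forall>z\<in>A. \<forall>f\<in>mor C x y. \<forall>g\<in>mor C y z.
        short_exact (full_subcategory C A) x y z f g \<longleftrightarrow> short_triangle Tri x y z f g)"

definition star ::
    "('o \<times> 'o \<times> 'o \<times> 'm \<times> 'm \<times> 'm) set \<Rightarrow> 'o set \<Rightarrow> 'o set \<Rightarrow> 'o set" where
  "star Tri A B = {e. \<exists>a\<in>A. \<exists>b\<in>B. \<exists>f g. short_triangle Tri a e b f g}"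

text \<open>The subcategory \<open>{0}\<close> is read as the set of all zero objects.\<close>

fun ext_power ::
    "('o, 'k, 'm) cat \<Rightarrow> ('o \<times> 'o \<times> 'o \<times> 'm \<times> 'm \<times> 'm) set \<Rightarrow> 'o set \<Rightarrow> nat \<Rightarrow> 'o set" where
  "ext_power C Tri S 0 = {z. is_zero_object C z}"
| "ext_power C Tri S (Suc n) = star Tri (ext_power C Tri S n) (S \<union> {z. is_zero_object C z})"

definition extension_closure ::
    "('o, 'k, 'm) cat \<Rightarrow> ('o \<times> 'o \<times> 'o \<times> 'm \<times> 'm \<times> 'm) set \<Rightarrow> 'o set \<Rightarrow> 'o set" where
  "extension_closure C Tri S = (\<Union>n. ext_power C Tri S n)"

definition End_ring :: "('o, 'k, 'm) cat \<Rightarrow> 'o \<Rightarrow> 'm ring" where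
  "End_ring C x = \<lparr>carrier = mor C x x, mult = Comp C, one = Ident C x,
     zero = \<zero>\<^bsub>Hom C x x\<^esub>, add = add (Hom C x x)\<rparr>"

locale skew_field = ring R for R (structure) +
  assumes one_not_zero: "\<one> \<noteq> \<zero>"
    and Units_eq: "Units R = carrier R - {\<zero>}"

definition orthogonal_collection ::
    "('o, 'k, 'm) cat \<Rightarrow> ('o, 'm) endofun \<Rightarrow> ('o, 'm) endofun \<Rightarrow> int \<Rightarrow> 'o set \<Rightarrow> bool" where
  "orthogonal_collection C Susp Desusp w S \<longleftrightarrow> 0 < w \<and> finite S \<and> S \<subseteq> Obj C \<and>
     (\<forall>s\<in>S. skew_field (End_ring C s)) \<and>
     (\<forall>s\<in>S. \<forall>t\<in>S. s \<noteq> t \<longrightarrow> mor C s t = {\<zero>\<^bsub>Hom C s t\<^esub>}) \<and>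
     (\<forall>s\<in>S. \<forall>t\<in>S. \<forall>l\<in>{- w + 1..-1}.
        mor C s (susp_power Susp Desusp l t) = {\<zero>\<^bsub>Hom C s (susp_power Susp Desusp l t)\<^esub>})"

end

theory Submission
  imports Defs
begin

text \<open>
  Let \<open>\<A>\<close> be the extension closure of \<open>S\<close>. Its objects are those with a finite filtration whose
  quotients lie in \<open>S\<close>, and they behave like modules of finite length. Two properties of triangles
  replace the usual properties of short exact sequences.

  First, since \<open>w \<ge> 2\<close>, there are no maps \<open>\<Sigma>s \<rightarrow> t\<close> between objects of \<open>S\<close>, hence none from \<open>\<Sigma>\<A>\<close> to \<open>\<A>\<close>
  (\<open>\<A>_negative\<close>). By the long exact sequences, in a triangle \<open>x \<rightarrow> y \<rightarrow> z\<close> with terms in \<open>\<A>\<close> the first map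
  is a kernel of the second and the second is a cokernel of the first.

  Second, a nonzero map from an object \<open>s\<close> of \<open>S\<close> to an object \<open>x\<close> with a filtration of length \<open>n\<close> has a
  cone with a filtration of length \<open>n - 1\<close> (\<open>brick_cone\<close>). This is Schur's lemma for \<open>S\<close> combined with
  the octahedral axiom: the composite of \<open>s \<rightarrow> x\<close> with the top quotient \<open>x \<rightarrow> t\<close> is zero or invertible. In
  the first case \<open>s \<rightarrow> x\<close> lifts to the next lower filtration step, in the second case the cone is that
  lower step.

  The core is that every map \<open>f : x \<rightarrow> y\<close> in \<open>\<A>\<close> either has its cone in \<open>\<A>\<close> or kills a nonzero map
  \<open>s \<rightarrow> x\<close> with \<open>s\<close> in \<open>S\<close> (\<open>inflation_or_kills_brick\<close>). To see this, take a nonzero \<open>g : s \<rightarrow> x\<close>. If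
  \<open>f \<cdot> g\<close> is nonzero, then \<open>g\<close> and \<open>f \<cdot> g\<close> both have a cone in \<open>\<A>\<close>, and by the octahedral axiom \<open>f\<close> has
  the same cone as the induced map between these cones, whose source has a shorter filtration;
  moreover, maps killed by the induced map lift to maps killed by \<open>f\<close>.

  As long as a map kills something, one may divide by it, and the source gets shorter. This ends with a
  factorization of \<open>f\<close> as a second map followed by a first map of two triangles in \<open>\<A>\<close>
  (\<open>image_factorization\<close>), which supplies kernels, cokernels and images. Hence \<open>\<A>\<close> is abelian with the
  triangles as short exact sequences. Its direct summands belong to it because idempotents split over
  their kernels. Filtrations with quotients in \<open>S\<close> are composition series by Schur's lemma, and every
  nonzero object has a subobject in \<open>S\<close>, which determines the simple objects.
\<close>

section \<open>Morphisms in preadditive categories\<close>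

context category
begin

text \<open>
  Hom-sets may overlap, so a morphism does not determine its source and target; every statement
  about composites carries them along in this form.
\<close>

definition arr :: "'m \<Rightarrow> 'o \<Rightarrow> 'o \<Rightarrow> bool" (\<open>\<guillemotleft>_ : _ \<rightarrow> _\<guillemotright>\<close>) where
  "\<guillemotleft>f : x \<rightarrow> y\<guillemotright> \<longleftrightarrow> x \<in> Obj C \<and> y \<in> Obj C \<and> f \<in> mor C x y"

lemma arr_dom: "\<guillemotleft>f : x \<rightarrow> y\<guillemotright> \<Longrightarrow> x \<in> Obj C"
  and arr_cod: "\<guillemotleft>f : x \<rightarrow> y\<guillemotright> \<Longrightarrow> y \<in> Obj C"
  by (auto simp: arr_def)

lemma arr_comp [intro]: "\<lbrakk>\<guillemotleft>f : x \<rightarrow> y\<guillemotright>; \<guillemotleft>g : y \<rightarrow> z\<guillemotright>\<rbrakk> \<Longrightarrow> \<guillemotleft>g \<cdot> f : x \<rightarrow> z\<guillemotright>"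
  by (auto simp: arr_def comp_closed)

lemma arr_ident [intro]: "x \<in> Obj C \<Longrightarrow> \<guillemotleft>Ident C x : x \<rightarrow> x\<guillemotright>"
  by (auto simp: arr_def ident_closed)

lemma assoc:
  "\<lbrakk>\<guillemotleft>f : x \<rightarrow> y\<guillemotright>; \<guillemotleft>g : y \<rightarrow> z\<guillemotright>; \<guillemotleft>h : z \<rightarrow> t\<guillemotright>\<rbrakk> \<Longrightarrow> (h \<cdot> g) \<cdot> f = h \<cdot> (g \<cdot> f)"
  by (auto simp: arr_def comp_assoc)

lemma ident_l [simp]: "\<guillemotleft>f : x \<rightarrow> y\<guillemotright> \<Longrightarrow> Ident C y \<cdot> f = f"
  and ident_r [simp]: "\<guillemotleft>f : x \<rightarrow> y\<guillemotright> \<Longrightarrow> f \<cdot> Ident C x = f"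
  by (auto simp: arr_def ident_left ident_right)

lemma is_iso_iff:
  "is_iso C x y f \<longleftrightarrow>
     \<guillemotleft>f : x \<rightarrow> y\<guillemotright> \<and> (\<exists>g. \<guillemotleft>g : y \<rightarrow> x\<guillemotright> \<and> g \<cdot> f = Ident C x \<and> f \<cdot> g = Ident C y)"
  by (auto simp: is_iso_def arr_def)

lemma is_isoI:
  "\<lbrakk>\<guillemotleft>f : x \<rightarrow> y\<guillemotright>; \<guillemotleft>g : y \<rightarrow> x\<guillemotright>; g \<cdot> f = Ident C x; f \<cdot> g = Ident C y\<rbrakk> \<Longrightarrow> is_iso C x y f"
  by (auto simp: is_iso_iff)

lemma is_isoE:
  assumes "is_iso C x y f"
  obtains g where "\<guillemotleft>f : x \<rightarrow> y\<guillemotright>" "\<guillemotleft>g : y \<rightarrow> x\<guillemotright>" "g \<cdot> f = Ident C x" "f \<cdot> g = Ident C y"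
    "is_iso C y x g"
  using assms by (auto simp: is_iso_iff)

lemma is_iso_ident: "x \<in> Obj C \<Longrightarrow> is_iso C x x (Ident C x)"
  by (rule is_isoI[OF arr_ident arr_ident]) (simp_all add: ident_l[OF arr_ident])

lemma is_iso_one_sided_inverses:
  assumes f: "\<guillemotleft>f : x \<rightarrow> y\<guillemotright>" and g: "\<guillemotleft>g : y \<rightarrow> x\<guillemotright>" "g \<cdot> f = Ident C x"
    and h: "\<guillemotleft>h : y \<rightarrow> x\<guillemotright>" "f \<cdot> h = Ident C y"
  shows "is_iso C x y f"
proof -
  have "g = g \<cdot> (f \<cdot> h)" using g h by simp
  also have "\<dots> = h" using assoc[OF h(1) f g(1)] g h by simp
  finally show ?thesis using f g h by (intro is_isoI[where g = g]) auto
qed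

lemma isomorphicI: "is_iso C x y f \<Longrightarrow> isomorphic C x y"
  unfolding isomorphic_def by blast

lemma isomorphic_sym: "isomorphic C x y \<Longrightarrow> isomorphic C y x"
  unfolding isomorphic_def by (meson is_isoE)

end

context preadditive_category
begin

abbreviation null :: "'o \<Rightarrow> 'o \<Rightarrow> 'm" where
  "null x y \<equiv> \<zero>\<^bsub>Hom C x y\<^esub>"

abbreviation neg :: "'o \<Rightarrow> 'o \<Rightarrow> 'm \<Rightarrow> 'm" where
  "neg x y f \<equiv> \<ominus>\<^bsub>Hom C x y\<^esub> f"

lemma arr_null [intro]: "\<lbrakk>x \<in> Obj C; y \<in> Obj C\<rbrakk> \<Longrightarrow> \<guillemotleft>null x y : x \<rightarrow> y\<guillemotright>"
  unfolding arr_def by (simp add: abelian_group.a_inv_closed abelian_groupE(2) hom_abelian_group)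

lemma arr_neg [intro]: "\<guillemotleft>f : x \<rightarrow> y\<guillemotright> \<Longrightarrow> \<guillemotleft>neg x y f : x \<rightarrow> y\<guillemotright>"
  unfolding arr_def by (simp add: abelian_group.a_inv_closed hom_abelian_group)

lemma comp_null_right [simp]:
  assumes "\<guillemotleft>g : y \<rightarrow> z\<guillemotright>" "x \<in> Obj C"
  shows "g \<cdot> null x y = null x z"
proof -
  have y: "y \<in> Obj C" and z: "z \<in> Obj C" using assms by (auto simp: arr_def)
  interpret X: abelian_group "Hom C x y" using hom_abelian_group assms(2) y .
  interpret Z: abelian_group "Hom C x z" using hom_abelian_group assms(2) z .
  have c: "g \<cdot> null x y \<in> mor C x z" using assms y z comp_closed by (auto simp: arr_def)
  have "g \<cdot> (null x y \<oplus>\<^bsub>Hom C x y\<^esub> null x y) = (g \<cdot> null x y) \<oplus>\<^bsub>Hom C x z\<^esub> (g \<cdot> null x y)"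
    using assms y z by (intro comp_add_right) (auto simp: arr_def)
  then show ?thesis using c by simp
qed

lemma comp_null_left [simp]:
  assumes "\<guillemotleft>f : x \<rightarrow> y\<guillemotright>" "z \<in> Obj C"
  shows "null y z \<cdot> f = null x z"
proof -
  have x: "x \<in> Obj C" and y: "y \<in> Obj C" using assms by (auto simp: arr_def)
  interpret Y: abelian_group "Hom C y z" using hom_abelian_group assms(2) y by blast
  interpret Z: abelian_group "Hom C x z" using hom_abelian_group assms(2) x by blast
  have c: "null y z \<cdot> f \<in> mor C x z" using assms x y comp_closed by (auto simp: arr_def)
  have "(null y z \<oplus>\<^bsub>Hom C y z\<^esub> null y z) \<cdot> f = (null y z \<cdot> f) \<oplus>\<^bsub>Hom C x z\<^esub> (null y z \<cdot> f)"
    using assms x y by (intro comp_add_left) (auto simp: arr_def)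
  then show ?thesis using c by simp
qed

lemma null_comp_null [simp]:
  "\<lbrakk>x \<in> Obj C; y \<in> Obj C; z \<in> Obj C\<rbrakk> \<Longrightarrow> null y z \<cdot> null x y = null x z"
  using comp_null_left[OF arr_null] .

lemma add_eq_right_iff:
  assumes "\<guillemotleft>d : x \<rightarrow> y\<guillemotright>" "\<guillemotleft>f : x \<rightarrow> y\<guillemotright>"
  shows "d \<oplus>\<^bsub>Hom C x y\<^esub> f = f \<longleftrightarrow> d = null x y"
proof -
  interpret abelian_group "Hom C x y" using hom_abelian_group assms by (auto simp: arr_def)
  show ?thesis using assms by (auto simp: arr_def)
qed

text \<open>
  Cancellation for two parallel maps is reduced to the vanishing of a single map, their
  difference \<open>d\<close>, to which exactness can be applied.
\<close>

lemma difference: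
  assumes "\<guillemotleft>f : x \<rightarrow> y\<guillemotright>" "\<guillemotleft>f' : x \<rightarrow> y\<guillemotright>"
  obtains d where "\<guillemotleft>d : x \<rightarrow> y\<guillemotright>" "d = null x y \<longleftrightarrow> f = f'"
    "\<And>z g. \<guillemotleft>g : y \<rightarrow> z\<guillemotright> \<Longrightarrow> g \<cdot> d = null x z \<longleftrightarrow> g \<cdot> f = g \<cdot> f'"
    "\<And>z g. \<guillemotleft>g : z \<rightarrow> x\<guillemotright> \<Longrightarrow> d \<cdot> g = null z y \<longleftrightarrow> f \<cdot> g = f' \<cdot> g"
proof -
  interpret abelian_group "Hom C x y" using hom_abelian_group assms by (auto simp: arr_def)
  define d where "d = f \<oplus>\<^bsub>Hom C x y\<^esub> neg x y f'"
  have d: "\<guillemotleft>d : x \<rightarrow> y\<guillemotright>" using assms by (auto simp: arr_def d_def)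
  have f: "f = d \<oplus>\<^bsub>Hom C x y\<^esub> f'"
    using assms by (auto simp: arr_def d_def a_assoc l_neg)
  show ?thesis
  proof
    show "\<guillemotleft>d : x \<rightarrow> y\<guillemotright>" by fact
    show "d = null x y \<longleftrightarrow> f = f'" using add_eq_right_iff[OF d assms(2)] f by simp
  next
    fix z g assume g: "\<guillemotleft>g : y \<rightarrow> z\<guillemotright>"
    have "g \<cdot> f = (g \<cdot> d) \<oplus>\<^bsub>Hom C x z\<^esub> (g \<cdot> f')"
      using comp_add_right[of x y z d f' g] assms d g f by (auto simp: arr_def)
    then show "g \<cdot> d = null x z \<longleftrightarrow> g \<cdot> f = g \<cdot> f'"
      using add_eq_right_iff[OF arr_comp[OF d g] arr_comp[OF assms(2) g]] by simp
  next
    fix z g assume g: "\<guillemotleft>g : z \<rightarrow> x\<guillemotright>"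
    have "f \<cdot> g = (d \<cdot> g) \<oplus>\<^bsub>Hom C z y\<^esub> (f' \<cdot> g)"
      using comp_add_left[of z x y g d f'] assms d g f by (auto simp: arr_def)
    then show "d \<cdot> g = null z y \<longleftrightarrow> f \<cdot> g = f' \<cdot> g"
      using add_eq_right_iff[OF arr_comp[OF g d] arr_comp[OF g assms(2)]] by simp
  qed
qed

lemma neg_neg [simp]: "\<guillemotleft>f : x \<rightarrow> y\<guillemotright> \<Longrightarrow> neg x y (neg x y f) = f"
  using abelian_group.minus_minus[OF hom_abelian_group] by (auto simp: arr_def)

lemma neg_eqI:
  assumes "\<guillemotleft>f : x \<rightarrow> y\<guillemotright>" "\<guillemotleft>g : x \<rightarrow> y\<guillemotright>" "f \<oplus>\<^bsub>Hom C x y\<^esub> g = null x y"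
  shows "f = neg x y g"
proof -
  interpret abelian_group "Hom C x y" using hom_abelian_group assms by (auto simp: arr_def)
  show ?thesis using assms minus_equality by (auto simp: arr_def)
qed

lemma neg_null [simp]:
  assumes "x \<in> Obj C" "y \<in> Obj C"
  shows "neg x y (null x y) = null x y"
proof -
  interpret abelian_group "Hom C x y" using hom_abelian_group assms by blast
  have "null x y = neg x y (null x y)" using assms by (intro neg_eqI arr_null) auto
  then show ?thesis by simp
qed

lemma neg_add [simp]: "\<guillemotleft>f : x \<rightarrow> y\<guillemotright> \<Longrightarrow> neg x y f \<oplus>\<^bsub>Hom C x y\<^esub> f = null x y"
  using abelian_group.l_neg[OF hom_abelian_group] by (auto simp: arr_def)

lemma comp_neg_right:
  assumes "\<guillemotleft>f : x \<rightarrow> y\<guillemotright>" "\<guillemotleft>g : y \<rightarrow> z\<guillemotright>"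
  shows "g \<cdot> neg x y f = neg x z (g \<cdot> f)"
proof (rule neg_eqI)
  have "g \<cdot> (neg x y f \<oplus>\<^bsub>Hom C x y\<^esub> f) = (g \<cdot> neg x y f) \<oplus>\<^bsub>Hom C x z\<^esub> (g \<cdot> f)"
    using assms arr_neg[OF assms(1)] by (intro comp_add_right) (auto simp: arr_def)
  then show "(g \<cdot> neg x y f) \<oplus>\<^bsub>Hom C x z\<^esub> (g \<cdot> f) = null x z"
    using assms arr_dom[OF assms(1)] by simp
qed (use assms in auto)

lemma comp_neg_left:
  assumes "\<guillemotleft>f : x \<rightarrow> y\<guillemotright>" "\<guillemotleft>g : y \<rightarrow> z\<guillemotright>"
  shows "neg y z g \<cdot> f = neg x z (g \<cdot> f)"
proof (rule neg_eqI)
  have "(neg y z g \<oplus>\<^bsub>Hom C y z\<^esub> g) \<cdot> f = (neg y z g \<cdot> f) \<oplus>\<^bsub>Hom C x z\<^esub> (g \<cdot> f)"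
    using assms arr_neg[OF assms(2)] by (intro comp_add_left) (auto simp: arr_def)
  then show "(neg y z g \<cdot> f) \<oplus>\<^bsub>Hom C x z\<^esub> (g \<cdot> f) = null x z"
    using assms arr_cod[OF assms(2)] by simp
qed (use assms in auto)

lemma neg_inject:
  assumes "neg x y f = neg x y g" "\<guillemotleft>f : x \<rightarrow> y\<guillemotright>" "\<guillemotleft>g : x \<rightarrow> y\<guillemotright>"
  shows "f = g"
  using arg_cong[OF assms(1), of "neg x y"] unfolding neg_neg[OF assms(2)] neg_neg[OF assms(3)] .

lemma neg_eq_null_iff:
  assumes "\<guillemotleft>f : x \<rightarrow> y\<guillemotright>"
  shows "neg x y f = null x y \<longleftrightarrow> f = null x y"
  using assms neg_neg neg_null arr_dom arr_cod by metis

lemma zero_object_Obj: "is_zero_object C z \<Longrightarrow> z \<in> Obj C"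
  by (simp add: is_zero_object_def)

lemma to_zero_object:
  assumes "is_zero_object C z" "\<guillemotleft>f : x \<rightarrow> z\<guillemotright>"
  shows "f = null x z"
  using assms arr_null[of x z] unfolding is_zero_object_def arr_def by metis

lemma from_zero_object:
  assumes "is_zero_object C z" "\<guillemotleft>f : z \<rightarrow> x\<guillemotright>"
  shows "f = null z x"
  using assms arr_null[of z x] unfolding is_zero_object_def arr_def by metis

lemma is_zero_object_iff:
  "is_zero_object C z \<longleftrightarrow> z \<in> Obj C \<and> Ident C z = null z z"
proof
  assume "is_zero_object C z"
  then show "z \<in> Obj C \<and> Ident C z = null z z"
    using to_zero_object zero_object_Obj arr_ident by blast
next
  assume z: "z \<in> Obj C \<and> Ident C z = null z z"
  have 1: "f = null x z" if "\<guillemotleft>f : x \<rightarrow> z\<guillemotright>" for x f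
    using z that ident_l comp_null_left by metis
  have 2: "f = null z x" if "\<guillemotleft>f : z \<rightarrow> x\<guillemotright>" for x f
    using z that ident_r comp_null_right by metis
  show "is_zero_object C z"
    unfolding is_zero_object_def
  proof (intro conjI ballI)
    fix x assume x: "x \<in> Obj C"
    show "\<exists>!f. f \<in> mor C x z" "\<exists>!f. f \<in> mor C z x"
      using z x 1[of _ x] 2[of _ x] arr_null[of x z] arr_null[of z x] by (auto simp: arr_def)
  qed (use z in blast)
qed

lemma zero_object_iso:
  assumes "is_zero_object C x" "is_iso C x y f"
  shows "is_zero_object C y"
proof -
  obtain g where "\<guillemotleft>f : x \<rightarrow> y\<guillemotright>" "\<guillemotleft>g : y \<rightarrow> x\<guillemotright>" "f \<cdot> g = Ident C y"
    using assms(2) by (rule is_isoE)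
  then show ?thesis
    using from_zero_object[OF assms(1)] is_zero_object_iff comp_null_left arr_cod by metis
qed

end
section \<open>Exactness in triangulated categories\<close>

context triangulated_category
begin

abbreviation sus :: "'o \<Rightarrow> 'o" where "sus \<equiv> omap Susp"
abbreviation susm :: "'m \<Rightarrow> 'm" where "susm \<equiv> amap Susp"

lemma sus_Obj [intro]: "x \<in> Obj C \<Longrightarrow> sus x \<in> Obj C"
  by (rule Susp.omap_closed)

lemma arr_susm [intro]: "\<guillemotleft>f : x \<rightarrow> y\<guillemotright> \<Longrightarrow> \<guillemotleft>susm f : sus x \<rightarrow> sus y\<guillemotright>"
  by (auto simp: arr_def Susp.omap_closed Susp.amap_closed)

lemma susm_ident [simp]: "x \<in> Obj C \<Longrightarrow> susm (Ident C x) = Ident C (sus x)"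
  by (rule Susp.amap_ident)

lemma susm_comp: "\<lbrakk>\<guillemotleft>f : x \<rightarrow> y\<guillemotright>; \<guillemotleft>g : y \<rightarrow> z\<guillemotright>\<rbrakk> \<Longrightarrow> susm (g \<cdot> f) = susm g \<cdot> susm f"
  by (auto simp: arr_def Susp.amap_comp)

lemma susm_null [simp]:
  assumes "x \<in> Obj C" "y \<in> Obj C"
  shows "susm (null x y) = null (sus x) (sus y)"
proof -
  interpret abelian_group "Hom C x y" using hom_abelian_group assms by blast
  have "susm (null x y) = susm (null x y) \<oplus>\<^bsub>Hom C (sus x) (sus y)\<^esub> susm (null x y)"
    using Susp_add[of x y "null x y" "null x y"] assms by simp
  then show ?thesis
    using add_eq_right_iff arr_susm arr_null assms by metis
qed

lemma nat_iso_idE: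
  assumes "naturally_isomorphic C (comp_fun G F) id_fun"
  obtains \<eta> where "\<And>x. x \<in> Obj C \<Longrightarrow> is_iso C (omap G (omap F x)) x (\<eta> x)"
    "\<And>x y f. \<guillemotleft>f : x \<rightarrow> y\<guillemotright> \<Longrightarrow> f \<cdot> \<eta> x = \<eta> y \<cdot> amap G (amap F f)"
proof -
  obtain \<eta> where "\<forall>x\<in>Obj C. is_iso C (omap G (omap F x)) x (\<eta> x)"
    "\<forall>x\<in>Obj C. \<forall>y\<in>Obj C. \<forall>f\<in>mor C x y. f \<cdot> \<eta> x = \<eta> y \<cdot> amap G (amap F f)"
    using assms by (auto simp: naturally_isomorphic_def comp_fun_def id_fun_def)
  then show ?thesis using that[of \<eta>] by (auto simp: arr_def)
qed

text \<open>Stated for a general pair of functors in order to cover both \<open>Susp\<close> and \<open>Desusp\<close>.\<close>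

lemma equivalence_unit_faithful:
  assumes F: "endofunctor C F" and G: "endofunctor C G"
    and iso: "naturally_isomorphic C (comp_fun G F) id_fun"
    and f: "\<guillemotleft>f : x \<rightarrow> y\<guillemotright>" and g: "\<guillemotleft>g : x \<rightarrow> y\<guillemotright>" and eq: "amap F f = amap F g"
  shows "f = g"
proof -
  obtain \<eta> where
    \<eta>: "\<And>x. x \<in> Obj C \<Longrightarrow> is_iso C (omap G (omap F x)) x (\<eta> x)"
    and nat: "\<And>x y f. \<guillemotleft>f : x \<rightarrow> y\<guillemotright> \<Longrightarrow> f \<cdot> \<eta> x = \<eta> y \<cdot> amap G (amap F f)"
    using nat_iso_idE[OF iso] by blast
  obtain \<theta> where \<theta>: "\<guillemotleft>\<eta> x : omap G (omap F x) \<rightarrow> x\<guillemotright>" "\<guillemotleft>\<theta> : x \<rightarrow> omap G (omap F x)\<guillemotright>"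
      "\<eta> x \<cdot> \<theta> = Ident C x"
    using \<eta>[OF arr_dom[OF f]] by (rule is_isoE)
  have "f \<cdot> \<eta> x = g \<cdot> \<eta> x" using nat[OF f] nat[OF g] eq by simp
  then have "f \<cdot> (\<eta> x \<cdot> \<theta>) = g \<cdot> (\<eta> x \<cdot> \<theta>)"
    using assoc[OF \<theta>(2,1) f] assoc[OF \<theta>(2,1) g] by simp
  then show ?thesis using \<theta> f g by simp
qed

lemma susm_faithful: "\<lbrakk>\<guillemotleft>f : x \<rightarrow> y\<guillemotright>; \<guillemotleft>g : x \<rightarrow> y\<guillemotright>; susm f = susm g\<rbrakk> \<Longrightarrow> f = g"
  by (rule equivalence_unit_faithful[OF Susp.endofunctor_axioms Desusp.endofunctor_axioms Desusp_Susp])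

lemma susm_eq_null: "\<lbrakk>\<guillemotleft>f : x \<rightarrow> y\<guillemotright>; susm f = null (sus x) (sus y)\<rbrakk> \<Longrightarrow> f = null x y"
  using susm_faithful[of f x y "null x y"] arr_null arr_dom arr_cod susm_null by metis

text \<open>
  Fullness of the suspension: conjugating \<open>Desusp g\<close> with the unit gives a map whose
  suspension agrees with \<open>g\<close> after applying the faithful functor \<open>Desusp\<close>.
\<close>

lemma susm_full:
  assumes g: "\<guillemotleft>g : sus x \<rightarrow> sus y\<guillemotright>" and x: "x \<in> Obj C" and y: "y \<in> Obj C"
  obtains f where "\<guillemotleft>f : x \<rightarrow> y\<guillemotright>" "susm f = g"
proof -
  let ?D = "omap Desusp" and ?d = "amap Desusp"
  obtain \<eta> where
    \<eta>: "\<And>x. x \<in> Obj C \<Longrightarrow> is_iso C (?D (sus x)) x (\<eta> x)"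
    and nat: "\<And>x y f. \<guillemotleft>f : x \<rightarrow> y\<guillemotright> \<Longrightarrow> f \<cdot> \<eta> x = \<eta> y \<cdot> ?d (susm f)"
    using nat_iso_idE[OF Desusp_Susp] by blast
  have arr_d: "\<guillemotleft>?d h : ?D a \<rightarrow> ?D b\<guillemotright>" if "\<guillemotleft>h : a \<rightarrow> b\<guillemotright>" for h a b
    using that by (auto simp: arr_def Desusp.omap_closed Desusp.amap_closed)
  obtain \<theta> where \<theta>: "\<guillemotleft>\<eta> x : ?D (sus x) \<rightarrow> x\<guillemotright>" "\<guillemotleft>\<theta> : x \<rightarrow> ?D (sus x)\<guillemotright>"
      "\<theta> \<cdot> \<eta> x = Ident C (?D (sus x))"
    using \<eta>[OF x] by (rule is_isoE)
  obtain \<zeta> where \<zeta>: "\<guillemotleft>\<eta> y : ?D (sus y) \<rightarrow> y\<guillemotright>" "\<guillemotleft>\<zeta> : y \<rightarrow> ?D (sus y)\<guillemotright>"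
      "\<zeta> \<cdot> \<eta> y = Ident C (?D (sus y))"
    using \<eta>[OF y] by (rule is_isoE)
  have dg: "\<guillemotleft>?d g : ?D (sus x) \<rightarrow> ?D (sus y)\<guillemotright>" using arr_d[OF g] .
  define f where "f = (\<eta> y \<cdot> ?d g) \<cdot> \<theta>"
  have f: "\<guillemotleft>f : x \<rightarrow> y\<guillemotright>" unfolding f_def using dg \<theta> \<zeta> by blast
  have dsf: "\<guillemotleft>?d (susm f) : ?D (sus x) \<rightarrow> ?D (sus y)\<guillemotright>" using arr_d arr_susm f by blast
  have "\<eta> y \<cdot> ?d (susm f) = f \<cdot> \<eta> x" using nat[OF f] by simp
  also have "\<dots> = (\<eta> y \<cdot> ?d g) \<cdot> (\<theta> \<cdot> \<eta> x)"
    unfolding f_def using assoc \<theta> \<zeta> dg by blast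
  also have "\<dots> = \<eta> y \<cdot> ?d g" using \<theta>(3) arr_comp[OF dg \<zeta>(1)] by simp
  finally have "\<zeta> \<cdot> (\<eta> y \<cdot> ?d (susm f)) = \<zeta> \<cdot> (\<eta> y \<cdot> ?d g)" by simp
  then have "?d (susm f) = ?d g"
    using assoc[OF dsf \<zeta>(1,2)] assoc[OF dg \<zeta>(1,2)] \<zeta>(3) dsf dg by simp
  then have "susm f = g"
    using equivalence_unit_faithful[OF Desusp.endofunctor_axioms Susp.endofunctor_axioms Susp_Desusp]
      arr_susm[OF f] g by blast
  with f show ?thesis using that by blast
qed

lemma isomorphic_if_isomorphic_sus:
  assumes "is_iso C (sus x) (sus y) h" "x \<in> Obj C" "y \<in> Obj C"
  shows "isomorphic C x y"
proof -
  obtain k where h: "\<guillemotleft>h : sus x \<rightarrow> sus y\<guillemotright>" and k: "\<guillemotleft>k : sus y \<rightarrow> sus x\<guillemotright>"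
    and kh: "k \<cdot> h = Ident C (sus x)" "h \<cdot> k = Ident C (sus y)"
    using assms(1) by (rule is_isoE)
  obtain f where f: "\<guillemotleft>f : x \<rightarrow> y\<guillemotright>" "susm f = h" using susm_full[OF h assms(2,3)] .
  obtain g where g: "\<guillemotleft>g : y \<rightarrow> x\<guillemotright>" "susm g = k" using susm_full[OF k assms(3,2)] .
  have "g \<cdot> f = Ident C x"
    using susm_faithful[of "g \<cdot> f" x x "Ident C x"] susm_comp[OF f(1) g(1)] f g kh assms(2) by auto
  moreover have "f \<cdot> g = Ident C y"
    using susm_faithful[of "f \<cdot> g" y y "Ident C y"] susm_comp[OF g(1) f(1)] f g kh assms(3) by auto
  ultimately show ?thesis unfolding isomorphic_def using f g is_isoI by blast
qed

lemma sus_zero_object: "is_zero_object C z \<Longrightarrow> is_zero_object C (sus z)"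
  unfolding is_zero_object_iff using susm_ident susm_null sus_Obj by metis

lemma Tri_arr:
  assumes "(x, y, z, u, v, w) \<in> Tri"
  shows "\<guillemotleft>u : x \<rightarrow> y\<guillemotright>" "\<guillemotleft>v : y \<rightarrow> z\<guillemotright>" "\<guillemotleft>w : z \<rightarrow> sus x\<guillemotright>" "x \<in> Obj C" "y \<in> Obj C" "z \<in> Obj C"
  using Tri_closed[OF assms] by (auto simp: arr_def)

lemma Tri_rotate_arr:
  assumes "\<guillemotleft>u : x \<rightarrow> y\<guillemotright>" "\<guillemotleft>v : y \<rightarrow> z\<guillemotright>" "\<guillemotleft>w : z \<rightarrow> sus x\<guillemotright>"
  shows "(x, y, z, u, v, w) \<in> Tri \<longleftrightarrow> (y, z, sus x, v, w, neg (sus x) (sus y) (susm u)) \<in> Tri"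
  using Tri_rotate assms by (auto simp: arr_def)

lemma Tri_rotated:
  "(x, y, z, u, v, w) \<in> Tri \<Longrightarrow> (y, z, sus x, v, w, neg (sus x) (sus y) (susm u)) \<in> Tri"
  using Tri_rotate_arr[OF Tri_arr(1-3)] by blast

lemma Tri_iso_arr:
  assumes "(x, y, z, u, v, w) \<in> Tri" "is_iso C x x' a" "is_iso C y y' b" "is_iso C z z' c"
    "\<guillemotleft>u' : x' \<rightarrow> y'\<guillemotright>" "\<guillemotleft>v' : y' \<rightarrow> z'\<guillemotright>" "\<guillemotleft>w' : z' \<rightarrow> sus x'\<guillemotright>"
    "b \<cdot> u = u' \<cdot> a" "c \<cdot> v = v' \<cdot> b" "susm a \<cdot> w = w' \<cdot> c"
  shows "(x', y', z', u', v', w') \<in> Tri"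
  using Tri_iso[OF assms(1-4), of u' v' w'] assms(5-) by (auto simp: arr_def)

lemma Tri_iso_first:
  assumes T: "(x, y, z, u, v, w) \<in> Tri"
    and a: "\<guillemotleft>a : x \<rightarrow> x'\<guillemotright>" "\<guillemotleft>a' : x' \<rightarrow> x\<guillemotright>" "a' \<cdot> a = Ident C x" "a \<cdot> a' = Ident C x'"
  shows "(x', y, z, u \<cdot> a', v, susm a \<cdot> w) \<in> Tri"
proof (rule Tri_iso_arr[OF T is_isoI[OF a] is_iso_ident is_iso_ident])
  note t = Tri_arr[OF T]
  show "y \<in> Obj C" "z \<in> Obj C" using t by auto
  show "\<guillemotleft>u \<cdot> a' : x' \<rightarrow> y\<guillemotright>" "\<guillemotleft>v : y \<rightarrow> z\<guillemotright>" "\<guillemotleft>susm a \<cdot> w : z \<rightarrow> sus x'\<guillemotright>" using t a by auto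
  then show "Ident C z \<cdot> v = v \<cdot> Ident C y" "susm a \<cdot> w = (susm a \<cdot> w) \<cdot> Ident C z" by auto
  show "Ident C y \<cdot> u = (u \<cdot> a') \<cdot> a" using t a assoc[OF a(1,2) t(1)] by simp
qed

lemma Tri_iso_middle:
  assumes T: "(x, y, z, u, v, w) \<in> Tri"
    and b: "\<guillemotleft>b : y \<rightarrow> y'\<guillemotright>" "\<guillemotleft>b' : y' \<rightarrow> y\<guillemotright>" "b' \<cdot> b = Ident C y" "b \<cdot> b' = Ident C y'"
  shows "(x, y', z, b \<cdot> u, v \<cdot> b', w) \<in> Tri"
proof (rule Tri_iso_arr[OF T is_iso_ident is_isoI[OF b] is_iso_ident])
  note t = Tri_arr[OF T]
  show "x \<in> Obj C" "z \<in> Obj C" using t by auto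
  show "\<guillemotleft>b \<cdot> u : x \<rightarrow> y'\<guillemotright>" "\<guillemotleft>v \<cdot> b' : y' \<rightarrow> z\<guillemotright>" "\<guillemotleft>w : z \<rightarrow> sus x\<guillemotright>" using t b by auto
  then show "b \<cdot> u = (b \<cdot> u) \<cdot> Ident C x" by simp
  show "Ident C z \<cdot> v = (v \<cdot> b') \<cdot> b" using t b assoc[OF b(1,2) t(2)] by simp
  show "susm (Ident C x) \<cdot> w = w \<cdot> Ident C z" using t by simp
qed

lemma Tri_iso_last:
  assumes T: "(x, y, z, u, v, w) \<in> Tri"
    and c: "\<guillemotleft>c : z \<rightarrow> z'\<guillemotright>" "\<guillemotleft>c' : z' \<rightarrow> z\<guillemotright>" "c' \<cdot> c = Ident C z" "c \<cdot> c' = Ident C z'"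
  shows "(x, y, z', u, c \<cdot> v, w \<cdot> c') \<in> Tri"
proof (rule Tri_iso_arr[OF T is_iso_ident is_iso_ident is_isoI[OF c]])
  note t = Tri_arr[OF T]
  show "x \<in> Obj C" "y \<in> Obj C" using t by auto
  show "\<guillemotleft>c \<cdot> v : y \<rightarrow> z'\<guillemotright>" "\<guillemotleft>w \<cdot> c' : z' \<rightarrow> sus x\<guillemotright>" "\<guillemotleft>u : x \<rightarrow> y\<guillemotright>" using t c by auto
  then show "Ident C y \<cdot> u = u \<cdot> Ident C x" "c \<cdot> v = (c \<cdot> v) \<cdot> Ident C y" by auto
  show "susm (Ident C x) \<cdot> w = (w \<cdot> c') \<cdot> c" using t c assoc[OF c(1,2) t(3)] by simp
qed

lemma Tri_complete_arr:
  assumes "\<guillemotleft>u : x \<rightarrow> y\<guillemotright>"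
  obtains z v w where "(x, y, z, u, v, w) \<in> Tri"
  using Tri_complete[of x y u] assms unfolding arr_def by blast

lemma Tri_zero_last:
  assumes "x \<in> Obj C" "is_zero_object C z"
  shows "(x, x, z, Ident C x, null x z, null z (sus x)) \<in> Tri"
  using Tri_ident assms by blast

lemma Tri_zero_first:
  assumes x: "x \<in> Obj C" and z: "is_zero_object C z"
  shows "(z, x, x, null z x, Ident C x, null x (sus z)) \<in> Tri"
proof -
  have zO: "z \<in> Obj C" and sz: "is_zero_object C (sus z)"
    using z zero_object_Obj sus_zero_object by auto
  have "null (sus z) (sus x) = neg (sus z) (sus x) (susm (null z x))"
    using x zO by (simp add: sus_Obj)
  then show ?thesis
    using Tri_zero_last[OF x sz] Tri_rotate_arr[of "null z x" z x "Ident C x" x "null x (sus z)"]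
      x zO by (simp add: arr_null arr_ident sus_Obj)
qed

text \<open>
  Exactness of the functors \<open>Hom(-, t)\<close> and \<open>Hom(t, -)\<close> at the second term: compare the triangle
  with the trivial one on \<open>t\<close>. For \<open>Hom(t, -)\<close> the axiom on morphisms of triangles
  has to be applied after rotation, where it yields the suspension of the required map.
\<close>

lemma Tri_factor_right:
  assumes T: "(x, y, z, u, v, w) \<in> Tri" and h: "\<guillemotleft>h : y \<rightarrow> t\<guillemotright>" "h \<cdot> u = null x t"
  obtains h' where "\<guillemotleft>h' : z \<rightarrow> t\<guillemotright>" "h' \<cdot> v = h"
proof -
  note t = Tri_arr[OF T]
  obtain o' where o': "is_zero_object C o'" using ex_zero_object by blast
  have O: "o' \<in> Obj C" "t \<in> Obj C" using o' zero_object_Obj h arr_cod by auto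
  have "h \<cdot> u = null o' t \<cdot> null x o'"
    using h t O by simp
  then obtain c where "c \<in> mor C z t" "c \<cdot> v = Ident C t \<cdot> h"
    using Tri_morphism[OF T Tri_zero_first[OF O(2) o'], of "null x o'" h] h arr_null[of x o'] O t
    by (auto simp: arr_def)
  then show ?thesis using that[of c] t O h by (auto simp: arr_def ident_left)
qed

lemma Tri_factor_left:
  assumes T: "(x, y, z, u, v, w) \<in> Tri" and g: "\<guillemotleft>g : t \<rightarrow> y\<guillemotright>" "v \<cdot> g = null t z"
  obtains g' where "\<guillemotleft>g' : t \<rightarrow> x\<guillemotright>" "u \<cdot> g' = g"
proof -
  note tr = Tri_arr[OF T]
  obtain o' where o': "is_zero_object C o'" using ex_zero_object by blast
  have O: "o' \<in> Obj C" "t \<in> Obj C" using o' zero_object_Obj g arr_dom by auto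
  have "null o' z \<cdot> null t o' = v \<cdot> g"
    using g tr O by simp
  then obtain c where c: "c \<in> mor C (sus t) (sus x)"
    "susm g \<cdot> neg (sus t) (sus t) (susm (Ident C t)) = neg (sus x) (sus y) (susm u) \<cdot> c"
    using Tri_morphism[OF Tri_rotated[OF Tri_zero_last[OF O(2) o']] Tri_rotated[OF T],
        of g "null o' z"] g arr_null[of o' z] O tr
    by (auto simp: arr_def)
  have ca: "\<guillemotleft>c : sus t \<rightarrow> sus x\<guillemotright>" using c(1) O tr by (auto simp: arr_def)
  have "neg (sus t) (sus y) (susm g) = neg (sus t) (sus y) (susm u \<cdot> c)"
    using c(2) comp_neg_left[OF ca arr_susm[OF tr(1)]]
      comp_neg_right[OF arr_ident[OF sus_Obj[OF O(2)]] arr_susm[OF g(1)]] O arr_susm[OF g(1)] by simp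
  then have eq: "susm g = susm u \<cdot> c"
    using neg_inject arr_susm[OF g(1)] arr_comp[OF ca arr_susm[OF tr(1)]] by blast
  obtain g' where g': "\<guillemotleft>g' : t \<rightarrow> x\<guillemotright>" "susm g' = c" using susm_full[OF ca O(2) tr(4)] .
  have "susm (u \<cdot> g') = susm g" using susm_comp[OF g'(1) tr(1)] g' eq by simp
  then have "u \<cdot> g' = g" using susm_faithful arr_comp[OF g'(1) tr(1)] g(1) by blast
  with g' that show ?thesis by blast
qed

lemma Tri_comp_null:
  assumes T: "(x, y, z, u, v, w) \<in> Tri"
  shows "v \<cdot> u = null x z" "w \<cdot> v = null y (sus x)" "susm u \<cdot> w = null z (sus y)"
proof -
  have *: "v \<cdot> u = null x z" if T: "(x, y, z, u, v, w) \<in> Tri" for x y z u v w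
  proof -
    note t = Tri_arr[OF T]
    obtain o' where o': "is_zero_object C o'" using ex_zero_object by blast
    obtain c where "c \<in> mor C o' z" "c \<cdot> null x o' = v \<cdot> u"
      using Tri_morphism[OF Tri_zero_last[OF t(4) o'] T, of "Ident C x" u] t arr_ident[OF t(4)]
      by (auto simp: arr_def)
    then show ?thesis
      using t o' zero_object_Obj comp_null_right[of c o' z x] by (auto simp: arr_def)
  qed
  note t = Tri_arr[OF T]
  show "v \<cdot> u = null x z" "w \<cdot> v = null y (sus x)"
    using *[OF T] *[OF Tri_rotated[OF T]] .
  have "neg z (sus y) (susm u \<cdot> w) = null z (sus y)"
    using *[OF Tri_rotated[OF Tri_rotated[OF T]]] comp_neg_left[OF t(3) arr_susm[OF t(1)]] by simp
  then show "susm u \<cdot> w = null z (sus y)"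
    using neg_eq_null_iff arr_comp[OF t(3) arr_susm[OF t(1)]] by blast
qed

lemma Tri_factor_right_sus:
  assumes T: "(x, y, z, u, v, w) \<in> Tri" and h: "\<guillemotleft>h : sus x \<rightarrow> t\<guillemotright>" "h \<cdot> w = null z t"
  obtains h' where "\<guillemotleft>h' : sus y \<rightarrow> t\<guillemotright>" "h' \<cdot> susm u = h"
proof -
  note t = Tri_arr[OF T]
  obtain h' where h': "\<guillemotleft>h' : sus y \<rightarrow> t\<guillemotright>" "h' \<cdot> neg (sus x) (sus y) (susm u) = h"
    using Tri_factor_right[OF Tri_rotated[OF Tri_rotated[OF T]] h] .
  have "neg (sus y) t h' \<cdot> susm u = h' \<cdot> neg (sus x) (sus y) (susm u)"
    using comp_neg_left comp_neg_right h'(1) arr_susm[OF t(1)] by metis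
  then show ?thesis using that h' arr_neg by metis
qed

lemma Tri_factor_left_sus:
  assumes T: "(x, y, z, u, v, w) \<in> Tri"
    and g: "\<guillemotleft>g : t \<rightarrow> sus x\<guillemotright>" "susm u \<cdot> g = null t (sus y)"
  obtains g' where "\<guillemotleft>g' : t \<rightarrow> z\<guillemotright>" "w \<cdot> g' = g"
proof -
  note tr = Tri_arr[OF T]
  have "neg (sus x) (sus y) (susm u) \<cdot> g = null t (sus y)"
    using comp_neg_left[OF g(1) arr_susm[OF tr(1)]] g tr arr_dom[OF g(1)] by (simp add: sus_Obj)
  then show ?thesis
    using Tri_factor_left[OF Tri_rotated[OF Tri_rotated[OF T]] g(1)] that by blast
qed

text \<open>
  A right inverse of \<open>u\<close> comes from exactness at \<open>y\<close>. A left inverse comes from exactness at \<open>\<Sigma>x\<close>,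
  so at first only for the suspension of \<open>u\<close>.
\<close>

lemma Tri_zero_last_iso:
  assumes T: "(x, y, z, u, v, w) \<in> Tri" and z: "is_zero_object C z"
  shows "is_iso C x y u"
proof -
  note t = Tri_arr[OF T]
  have "v \<cdot> Ident C y = null y z" "Ident C (sus x) \<cdot> w = null z (sus x)"
    using to_zero_object[OF z] from_zero_object[OF z] t by auto
  then obtain g k where g: "\<guillemotleft>g : y \<rightarrow> x\<guillemotright>" "u \<cdot> g = Ident C y"
    and k: "\<guillemotleft>k : sus y \<rightarrow> sus x\<guillemotright>" "k \<cdot> susm u = Ident C (sus x)"
    using Tri_factor_left[OF T arr_ident[OF t(5)]] t
      Tri_factor_right_sus[OF T arr_ident[OF sus_Obj[OF t(4)]]] by metis
  obtain h where h: "\<guillemotleft>h : y \<rightarrow> x\<guillemotright>" "susm h = k" using susm_full[OF k(1) t(5,4)] .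
  have "h \<cdot> u = Ident C x"
    using susm_faithful[of "h \<cdot> u" x x "Ident C x"] susm_comp[OF t(1) h(1)] h k t by auto
  then show ?thesis using is_iso_one_sided_inverses[OF t(1)] g h by blast
qed

lemma Tri_zero_first_iso:
  assumes T: "(x, y, z, u, v, w) \<in> Tri" and x: "is_zero_object C x"
  shows "is_iso C y z v"
  using Tri_zero_last_iso[OF Tri_rotated[OF T] sus_zero_object[OF x]] .

lemma Tri_of_iso:
  assumes "is_iso C x y u" "is_zero_object C z"
  shows "(x, y, z, u, null y z, null z (sus x)) \<in> Tri"
proof -
  obtain g where g: "\<guillemotleft>u : x \<rightarrow> y\<guillemotright>" "\<guillemotleft>g : y \<rightarrow> x\<guillemotright>" "g \<cdot> u = Ident C x" "u \<cdot> g = Ident C y"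
    using assms(1) by (rule is_isoE)
  have "x \<in> Obj C" "z \<in> Obj C" using g arr_dom zero_object_Obj assms by auto
  then show ?thesis
    using Tri_iso_middle[OF Tri_zero_last[OF _ assms(2)] g] g by simp
qed

lemma sus_essentially_surjective:
  assumes "c \<in> Obj C"
  obtains x \<epsilon> where "x \<in> Obj C" "is_iso C c (sus x) \<epsilon>"
proof -
  have "\<exists>\<epsilon>. is_iso C (sus (omap Desusp c)) c \<epsilon>"
    using Susp_Desusp assms by (auto simp: naturally_isomorphic_def comp_fun_def id_fun_def)
  then show ?thesis using that[of "omap Desusp c"] Desusp.omap_closed assms is_isoE by metis
qed

lemma Tri_fibre:
  assumes v: "\<guillemotleft>v : y \<rightarrow> z\<guillemotright>"
  obtains x u w where "(x, y, z, u, v, w) \<in> Tri"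
proof -
  obtain c a b where T: "(y, z, c, v, a, b) \<in> Tri" using Tri_complete_arr[OF v] .
  note t = Tri_arr[OF T]
  obtain x \<epsilon> where x: "x \<in> Obj C" and i: "is_iso C c (sus x) \<epsilon>"
    using sus_essentially_surjective[OF t(6)] .
  obtain \<delta> where \<epsilon>: "\<guillemotleft>\<epsilon> : c \<rightarrow> sus x\<guillemotright>" "\<guillemotleft>\<delta> : sus x \<rightarrow> c\<guillemotright>" "\<delta> \<cdot> \<epsilon> = Ident C c" "\<epsilon> \<cdot> \<delta> = Ident C (sus x)"
    using i by (rule is_isoE)
  have T': "(y, z, sus x, v, \<epsilon> \<cdot> a, b \<cdot> \<delta>) \<in> Tri" using Tri_iso_last[OF T \<epsilon>] .
  note t' = Tri_arr[OF T']
  obtain u where u: "\<guillemotleft>u : x \<rightarrow> y\<guillemotright>" "susm u = neg (sus x) (sus y) (b \<cdot> \<delta>)"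
    using susm_full[OF arr_neg[OF t'(3)] x t(4)] .
  then have "neg (sus x) (sus y) (susm u) = b \<cdot> \<delta>" using neg_neg[OF t'(3)] by simp
  then show ?thesis using that Tri_rotate_arr[OF u(1) v t'(2)] T' by simp
qed

text \<open>Three inverse rotations, with the signs absorbed into the maps.\<close>

lemma Tri_desuspend:
  assumes T: "(sus x, sus y, sus z, a, b, c) \<in> Tri" and O: "x \<in> Obj C" "y \<in> Obj C" "z \<in> Obj C"
  obtains u v w where "(x, y, z, u, v, w) \<in> Tri"
proof -
  note t = Tri_arr[OF T]
  have *: "\<exists>f. \<guillemotleft>f : x \<rightarrow> y\<guillemotright> \<and> neg (sus x) (sus y) (susm f) = g"
    if g: "\<guillemotleft>g : sus x \<rightarrow> sus y\<guillemotright>" and xy: "x \<in> Obj C" "y \<in> Obj C" for g x y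
  proof -
    obtain f where "\<guillemotleft>f : x \<rightarrow> y\<guillemotright>" "susm f = neg (sus x) (sus y) g"
      using susm_full[OF arr_neg[OF g] xy] .
    then show ?thesis using neg_neg[OF g] by auto
  qed
  obtain u where u: "\<guillemotleft>u : x \<rightarrow> y\<guillemotright>" "neg (sus x) (sus y) (susm u) = a" using * t O by blast
  obtain v where v: "\<guillemotleft>v : y \<rightarrow> z\<guillemotright>" "neg (sus y) (sus z) (susm v) = b" using * t O by blast
  obtain w where w: "\<guillemotleft>w : z \<rightarrow> sus x\<guillemotright>" "neg (sus z) (sus (sus x)) (susm w) = c" using * t O by blast
  have "(x, y, z, u, v, w) \<in> Tri"
    using T Tri_rotate_arr[OF u(1) v(1) w(1)]
      Tri_rotate_arr[OF v(1) w(1), of "neg (sus x) (sus y) (susm u)"]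
      Tri_rotate_arr[OF w(1), of "neg (sus x) (sus y) (susm u)" "sus y" "neg (sus y) (sus z) (susm v)"]
      arr_susm[OF u(1)] arr_susm[OF v(1)] u v w by auto
  then show ?thesis using that by blast
qed

text \<open>
  The fibre of a composite is an extension of the fibres of its factors. This is the octahedral
  axiom for the rotated triangles, where the fibres appear suspended.
\<close>

lemma fibre_of_composite:
  assumes f: "(a, y, z, \<alpha>, f, \<alpha>') \<in> Tri" and g: "(b, z, t, \<beta>, g, \<beta>') \<in> Tri"
    and gf: "(k, y, t, \<kappa>, g \<cdot> f, \<kappa>') \<in> Tri"
  obtains p q r where "(a, k, b, p, q, r) \<in> Tri"
proof -
  obtain p q r where "(sus a, sus k, sus b, p, q, r) \<in> Tri"
    using Tri_octahedral[OF Tri_rotated[OF f] Tri_rotated[OF g] Tri_rotated[OF gf]] by blast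
  then show ?thesis using Tri_desuspend Tri_arr(4)[OF f] Tri_arr(4)[OF g] Tri_arr(4)[OF gf] that by metis
qed

text \<open>
  The injection of \<open>a\<close> is split, so its suspension is too; as it annihilates the third map of the
  triangle on this injection, that map is zero. Hence the second map \<open>v\<close> is epic, and the map
  from the cone to \<open>b\<close> induced by the projection has the inverse \<open>v \<cdot> j\<close>.
\<close>

lemma direct_sum_triangle:
  assumes "is_direct_sum C a b s"
  obtains c u v w where "(a, s, c, u, v, w) \<in> Tri" "isomorphic C c b"
proof -
  obtain i j p q where i: "\<guillemotleft>i : a \<rightarrow> s\<guillemotright>" and j: "\<guillemotleft>j : b \<rightarrow> s\<guillemotright>" and p: "\<guillemotleft>p : s \<rightarrow> a\<guillemotright>" and q: "\<guillemotleft>q : s \<rightarrow> b\<guillemotright>"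
    and pi: "p \<cdot> i = Ident C a" and qj: "q \<cdot> j = Ident C b"
    and qi: "q \<cdot> i = null a b"
    and sum: "(i \<cdot> p) \<oplus>\<^bsub>Hom C s s\<^esub> (j \<cdot> q) = Ident C s"
    using assms unfolding is_direct_sum_def arr_def by metis
  obtain c v w where T: "(a, s, c, i, v, w) \<in> Tri" using Tri_complete_arr[OF i] .
  note t = Tri_arr[OF T]
  have w0: "w = null c (sus a)"
  proof -
    have "w = susm (p \<cdot> i) \<cdot> w" using pi t by simp
    also have "\<dots> = susm p \<cdot> (susm i \<cdot> w)"
      using susm_comp[OF i p] assoc[OF t(3) arr_susm[OF i] arr_susm[OF p]] by simp
    also have "\<dots> = null c (sus a)"
      using Tri_comp_null(3)[OF T] comp_null_right[OF arr_susm[OF p] t(6)] by simp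
    finally show ?thesis .
  qed
  obtain h where h: "\<guillemotleft>h : c \<rightarrow> b\<guillemotright>" "h \<cdot> v = q"
    using Tri_factor_right[OF T q qi] .
  have 1: "h \<cdot> (v \<cdot> j) = Ident C b" using assoc[OF j t(2) h(1)] h qj by simp
  have "v = v \<cdot> ((i \<cdot> p) \<oplus>\<^bsub>Hom C s s\<^esub> (j \<cdot> q))" using sum t by simp
  also have "\<dots> = (v \<cdot> (i \<cdot> p)) \<oplus>\<^bsub>Hom C s c\<^esub> (v \<cdot> (j \<cdot> q))"
    using arr_comp[OF p i] arr_comp[OF q j] t(2) by (intro comp_add_right) (auto simp: arr_def)
  also have "v \<cdot> (i \<cdot> p) = null s c"
    using assoc[OF p i t(2)] Tri_comp_null(1)[OF T] p t by simp
  also have "null s c \<oplus>\<^bsub>Hom C s c\<^esub> (v \<cdot> (j \<cdot> q)) = v \<cdot> (j \<cdot> q)"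
    using abelian_groupE(5)[OF hom_abelian_group, of s c] arr_comp[OF arr_comp[OF q j] t(2)]
    by (auto simp: arr_def)
  also have "\<dots> = ((v \<cdot> j) \<cdot> h) \<cdot> v"
    using assoc[OF t(2) h(1) arr_comp[OF j t(2)]] assoc[OF q j t(2)] h by simp
  finally have eq: "((v \<cdot> j) \<cdot> h) \<cdot> v = Ident C c \<cdot> v" using t by simp
  have vjh: "\<guillemotleft>(v \<cdot> j) \<cdot> h : c \<rightarrow> c\<guillemotright>" using h j t by blast
  obtain d where d: "\<guillemotleft>d : c \<rightarrow> c\<guillemotright>" "d = null c c \<longleftrightarrow> (v \<cdot> j) \<cdot> h = Ident C c" "d \<cdot> v = null s c"
    using difference[OF vjh arr_ident[OF t(6)]] eq t(2) by metis
  obtain e where e: "\<guillemotleft>e : sus a \<rightarrow> c\<guillemotright>" "e \<cdot> w = d"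
    using Tri_factor_right[OF Tri_rotated[OF T] d(1,3)] .
  have "d = null c c" using e w0 t by simp
  then have "(v \<cdot> j) \<cdot> h = Ident C c" using d by simp
  then have "isomorphic C c b"
    unfolding isomorphic_def using is_isoI[OF h(1) arr_comp[OF j t(2)]] 1 by blast
  then show ?thesis using that T by blast
qed

end
section \<open>Filtrations by orthogonal objects\<close>

text \<open>
  Orthogonality as conditions on single maps: the skew field condition becomes Schur's lemma, and the
  vanishing in degree \<open>-1\<close> is transported to maps out of suspensions.
\<close>

locale orthogonal_bricks = triangulated_category K C Susp Desusp Tri
  for K :: "'k ring" and C :: "('o, 'k, 'm) cat" (structure)
    and Susp Desusp :: "('o, 'm) endofun"
    and Tri :: "('o \<times> 'o \<times> 'o \<times> 'm \<times> 'm \<times> 'm) set" +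
  fixes S :: "'o set"
  assumes S_Obj: "s \<in> S \<Longrightarrow> s \<in> Obj C"
    and brick_nonzero: "s \<in> S \<Longrightarrow> \<not> is_zero_object C s"
    and brick_iso: "\<lbrakk>s \<in> S; \<guillemotleft>f : s \<rightarrow> s\<guillemotright>; f \<noteq> null s s\<rbrakk> \<Longrightarrow> is_iso C s s f"
    and brick_orth: "\<lbrakk>s \<in> S; t \<in> S; \<guillemotleft>f : s \<rightarrow> t\<guillemotright>; s \<noteq> t\<rbrakk> \<Longrightarrow> f = null s t"
    and brick_negative: "\<lbrakk>s \<in> S; t \<in> S; \<guillemotleft>f : sus s \<rightarrow> t\<guillemotright>\<rbrakk> \<Longrightarrow> f = null (sus s) t"
begin

text \<open>
  In contrast to the powers of \<open>S\<close>, zero objects are excluded as quotients. Then dividing by an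
  object of \<open>S\<close> lowers the index by exactly one, which is what the inductions below run on.
\<close>

inductive filt :: "nat \<Rightarrow> 'o \<Rightarrow> bool" where
  zero: "is_zero_object C z \<Longrightarrow> filt 0 z"
| step: "\<lbrakk>filt n x; s \<in> S; (x, y, s, u, v, w) \<in> Tri\<rbrakk> \<Longrightarrow> filt (Suc n) y"

definition \<A> :: "'o set" where
  "\<A> = {x. \<exists>n. filt n x}"

lemma filt_0_iff: "filt 0 x \<longleftrightarrow> is_zero_object C x"
  by (auto elim: filt.cases intro: filt.zero)

lemma filt_SucE:
  assumes "filt (Suc n) y"
  obtains x s u v w where "filt n x" "s \<in> S" "(x, y, s, u, v, w) \<in> Tri"
  using assms by (cases rule: filt.cases) auto

lemma filt_Obj: "filt n x \<Longrightarrow> x \<in> Obj C"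
  by (induction rule: filt.induct) (auto dest: zero_object_Obj Tri_arr)

lemma \<A>_Obj: "x \<in> \<A> \<Longrightarrow> x \<in> Obj C"
  unfolding \<A>_def using filt_Obj by blast

lemma zero_in_\<A>: "is_zero_object C z \<Longrightarrow> z \<in> \<A>"
  unfolding \<A>_def using filt.zero by blast

lemma filt_iso:
  assumes "filt n x" "is_iso C x y b"
  shows "filt n y"
  using assms(1)
proof (cases rule: filt.cases)
  case zero
  then show ?thesis using filt.zero zero_object_iso assms(2) by blast
next
  case (step n' x' s u v w)
  obtain b' where b: "\<guillemotleft>b : x \<rightarrow> y\<guillemotright>" "\<guillemotleft>b' : y \<rightarrow> x\<guillemotright>" "b' \<cdot> b = Ident C x" "b \<cdot> b' = Ident C y"
    using assms(2) by (rule is_isoE)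
  show ?thesis
    using filt.step[OF step(2,3) Tri_iso_middle[OF step(4) b]] step(1) by simp
qed

lemma \<A>_isomorphic: "\<lbrakk>x \<in> \<A>; isomorphic C x y\<rbrakk> \<Longrightarrow> y \<in> \<A>"
  unfolding \<A>_def isomorphic_def using filt_iso by blast

text \<open>
  The steps with a zero quotient that are permitted in the powers of \<open>S\<close> are isomorphisms,
  so the filtrations with quotients in \<open>S\<close> reach all of the extension closure.
\<close>

lemma extension_closure_eq: "extension_closure C Tri S = \<A>"
proof
  have "filt n x \<Longrightarrow> x \<in> ext_power C Tri S n" for n x
    by (induction rule: filt.induct) (auto simp: star_def short_triangle_def, blast)
  then show "\<A> \<subseteq> extension_closure C Tri S"
    unfolding \<A>_def extension_closure_def by blast
  have "e \<in> ext_power C Tri S n \<Longrightarrow> e \<in> \<A>" for n e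
  proof (induction n arbitrary: e)
    case 0
    then show ?case using zero_in_\<A> by simp
  next
    case (Suc n)
    then obtain a b u v w where a: "a \<in> ext_power C Tri S n" and b: "b \<in> S \<or> is_zero_object C b"
      and T: "(a, e, b, u, v, w) \<in> Tri"
      unfolding ext_power.simps star_def short_triangle_def by blast
    have "a \<in> \<A>" using Suc.IH a .
    from b show ?case
    proof
      assume "b \<in> S"
      with \<open>a \<in> \<A>\<close> T show ?thesis unfolding \<A>_def using filt.step by blast
    next
      assume "is_zero_object C b"
      then show ?thesis
        using \<A>_isomorphic \<open>a \<in> \<A>\<close> Tri_zero_last_iso[OF T] unfolding isomorphic_def by blast
    qed
  qed
  then show "extension_closure C Tri S \<subseteq> \<A>"
    unfolding extension_closure_def by blast
qed

lemma S_subset_\<A>: "s \<in> S \<Longrightarrow> s \<in> \<A>"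
proof -
  assume s: "s \<in> S"
  obtain z where "is_zero_object C z" using ex_zero_object by blast
  then show "s \<in> \<A>"
    unfolding \<A>_def using filt.step[OF filt.zero s Tri_zero_first[OF S_Obj[OF s]]] by blast
qed

text \<open>
  Peel off the top quotient \<open>t\<close> of \<open>z\<close>: the fibre of \<open>y \<rightarrow> z \<rightarrow> t\<close> is an extension of the next
  lower step of the filtration of \<open>z\<close> by \<open>x\<close>.
\<close>

lemma \<A>_extension_closed:
  assumes T: "(x, y, z, u, v, w) \<in> Tri" and x: "x \<in> \<A>" and z: "z \<in> \<A>"
  shows "y \<in> \<A>"
proof -
  obtain n where "filt n z" using z \<A>_def by blast
  then show ?thesis using T
  proof (induction n arbitrary: y z u v w)
    case 0
    then show ?case
      using \<A>_isomorphic[OF x] Tri_zero_last_iso filt_0_iff isomorphic_def by metis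
  next
    case (Suc n)
    obtain z' t p q r where z': "filt n z'" and t: "t \<in> S" and T': "(z', z, t, p, q, r) \<in> Tri"
      using Suc.prems(1) by (rule filt_SucE)
    have "\<guillemotleft>q \<cdot> v : y \<rightarrow> t\<guillemotright>" using Tri_arr(2)[OF T'] Tri_arr(2)[OF Suc.prems(2)] by blast
    then obtain k \<kappa> \<kappa>' where T'': "(k, y, t, \<kappa>, q \<cdot> v, \<kappa>') \<in> Tri" using Tri_fibre by blast
    obtain a b c where "(x, k, z', a, b, c) \<in> Tri"
      using fibre_of_composite[OF Suc.prems(2) T' T''] .
    then have "k \<in> \<A>" using Suc.IH z' by blast
    then show ?case unfolding \<A>_def using filt.step t T'' by blast
  qed
qed

text \<open>
  Devissage in both arguments along the filtrations, first in the target, then in the source.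
\<close>

lemma \<A>_negative:
  assumes x: "x \<in> \<A>" and y: "y \<in> \<A>" and f: "\<guillemotleft>f : sus x \<rightarrow> y\<guillemotright>"
  shows "f = null (sus x) y"
proof -
  have *: "f = null (sus s) y" if "filt n y" "s \<in> S" "\<guillemotleft>f : sus s \<rightarrow> y\<guillemotright>" for n s y f
    using that
  proof (induction arbitrary: f rule: filt.induct)
    case (zero z)
    then show ?case using to_zero_object by blast
  next
    case (step n x t y u v w)
    note tr = Tri_arr[OF step(3)]
    have "v \<cdot> f = null (sus s) t"
      using brick_negative[OF step(5,2) arr_comp[OF step(6) tr(2)]] .
    then obtain g where g: "\<guillemotleft>g : sus s \<rightarrow> x\<guillemotright>" "u \<cdot> g = f"
      using Tri_factor_left[OF step(3,6)] by blast
    then have "g = null (sus s) x" using step by blast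
    then show ?case using g tr arr_dom[OF step(6)] by auto
  qed
  obtain n where "filt n x" using x \<A>_def by blast
  then show ?thesis using f
  proof (induction arbitrary: f rule: filt.induct)
    case (zero z)
    then show ?case using from_zero_object sus_zero_object by blast
  next
    case (step n x' s x u v w)
    note tr = Tri_arr[OF step(3)]
    have uf: "f \<cdot> susm u = null (sus x') y" using step(4) arr_comp[OF arr_susm[OF tr(1)] step(5)] .
    have "f \<cdot> neg (sus x') (sus x) (susm u) = null (sus x') y"
      using comp_neg_right[OF arr_susm[OF tr(1)] step(5)] uf tr arr_cod[OF step(5)] by (simp add: sus_Obj)
    then obtain h where h: "\<guillemotleft>h : sus s \<rightarrow> y\<guillemotright>" "h \<cdot> susm v = f"
      using Tri_factor_right_sus[OF Tri_rotated[OF step(3)] step(5)] by blast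
    obtain m where "filt m y" using y \<A>_def by blast
    then have "h = null (sus s) y" using * step(2) h(1) by blast
    then show ?case using h comp_null_left[OF arr_susm[OF tr(2)]] arr_cod[OF step(5)] by auto
  qed
qed

text \<open>
  Vanishing of maps \<open>\<Sigma>\<A> \<rightarrow> \<A>\<close> makes the first map of a triangle in \<open>\<A>\<close> monic
  and the second one epic.
\<close>

lemma Tri_mono:
  assumes T: "(x, y, z, u, v, w) \<in> Tri" and "z \<in> \<A>" "t \<in> \<A>"
    and g: "\<guillemotleft>g : t \<rightarrow> x\<guillemotright>" "u \<cdot> g = null t y"
  shows "g = null t x"
proof -
  note tr = Tri_arr[OF T]
  have O: "t \<in> Obj C" using assms \<A>_Obj by blast
  have "susm u \<cdot> susm g = null (sus t) (sus y)"
    using susm_comp[OF g(1) tr(1)] g(2) O tr by simp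
  then obtain m where m: "\<guillemotleft>m : sus t \<rightarrow> z\<guillemotright>" "w \<cdot> m = susm g"
    using Tri_factor_left_sus[OF T arr_susm[OF g(1)]] by blast
  then have "susm g = null (sus t) (sus x)"
    using \<A>_negative[OF assms(3,2) m(1)] comp_null_right[OF tr(3) sus_Obj[OF O]] by simp
  then show ?thesis using susm_eq_null g(1) by blast
qed

lemma Tri_epi:
  assumes T: "(x, y, z, u, v, w) \<in> Tri" and "x \<in> \<A>" "t \<in> \<A>"
    and h: "\<guillemotleft>h : z \<rightarrow> t\<guillemotright>" "h \<cdot> v = null y t"
  shows "h = null z t"
proof -
  note tr = Tri_arr[OF T]
  obtain m where m: "\<guillemotleft>m : sus x \<rightarrow> t\<guillemotright>" "m \<cdot> w = h"
    using Tri_factor_right[OF Tri_rotated[OF T] h] .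
  then show ?thesis
    using \<A>_negative[OF assms(2,3) m(1)] comp_null_left[OF tr(3) arr_cod[OF h(1)]] by simp
qed

text \<open>
  The lift or the splitting is decided by the top quotient \<open>t\<close> of \<open>x\<close>: the composite \<open>s \<rightarrow> x \<rightarrow> t\<close> is zero
  or, by Schur's lemma, an isomorphism. The exact index of the cone is what makes the later inductions
  on the length of the source terminate.
\<close>

lemma brick_cone:
  assumes "filt n x" "s \<in> S" "\<guillemotleft>f : s \<rightarrow> x\<guillemotright>" "f \<noteq> null s x"
  obtains m c v w where "n = Suc m" "filt m c" "(s, x, c, f, v, w) \<in> Tri"
proof -
  have "\<exists>m c v w. n = Suc m \<and> filt m c \<and> (s, x, c, f, v, w) \<in> Tri"
    using assms(1,3,4)
  proof (induction arbitrary: f rule: filt.induct)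
    case (zero z)
    then show ?case using to_zero_object by blast
  next
    case (step n x t y u v w)
    note tr = Tri_arr[OF step(3)]
    obtain c i i' where c: "(s, y, c, f, i, i') \<in> Tri" using Tri_complete_arr[OF step(5)] .
    show ?case
    proof (cases "v \<cdot> f = null s t")
      case True
      obtain f' where f': "\<guillemotleft>f' : s \<rightarrow> x\<guillemotright>" "u \<cdot> f' = f"
        using Tri_factor_left[OF step(3,5) True] .
      have "f' \<noteq> null s x" using f' step(6) comp_null_right[OF tr(1) arr_dom[OF f'(1)]] by auto
      then obtain m b j j' where m: "n = Suc m" "filt m b" and b: "(s, x, b, f', j, j') \<in> Tri"
        using step(4)[OF f'(1)] by blast
      obtain p q r where "(b, c, t, p, q, r) \<in> Tri"
        using Tri_octahedral[OF b step(3), of c i i'] c f'(2) by blast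
      then show ?thesis using filt.step[OF m(2) step(2)] m(1) c by blast
    next
      case False
      have vf: "\<guillemotleft>v \<cdot> f : s \<rightarrow> t\<guillemotright>" using step(5) tr(2) by blast
      have "s = t" using brick_orth[OF assms(2) step(2) vf] False by blast
      then have iso: "is_iso C s t (v \<cdot> f)" using brick_iso[OF assms(2)] vf False by simp
      obtain z where z: "is_zero_object C z" using ex_zero_object by blast
      \<comment> \<open>The composite \<open>v \<cdot> f\<close> has cone zero, so the octahedron identifies the cone of \<open>f\<close>
        with the fibre \<open>x\<close> of \<open>v\<close>, up to one suspension.\<close>
      obtain p q r where "(c, z, sus x, p, q, r) \<in> Tri"
        using Tri_octahedral[OF c Tri_rotated[OF step(3)] Tri_of_iso[OF iso z]] by blast
      then have "is_iso C (sus x) (sus c) r"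
        using Tri_zero_first_iso[OF Tri_rotated z] by blast
      then have "isomorphic C x c"
        using isomorphic_if_isomorphic_sus tr(4) Tri_arr(6)[OF c] by blast
      then have "filt n c" using filt_iso step(1) isomorphic_def by metis
      then show ?thesis using c by blast
    qed
  qed
  then show ?thesis using that by blast
qed

text \<open>
  Filtrations are built from the bottom, so the lowest step is isomorphic to an object of \<open>S\<close>; the maps
  between the steps are monic, so the resulting map to \<open>x\<close> does not vanish.
\<close>

lemma brick_subobject:
  assumes "filt (Suc n) x"
  obtains s f where "s \<in> S" "\<guillemotleft>f : s \<rightarrow> x\<guillemotright>" "f \<noteq> null s x"
proof -
  have "\<exists>s\<in>S. \<exists>f. \<guillemotleft>f : s \<rightarrow> x\<guillemotright> \<and> f \<noteq> null s x"
    using assms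
  proof (induction n arbitrary: x)
    case 0
    obtain x' s u v w where x': "filt 0 x'" and s: "s \<in> S" and T: "(x', x, s, u, v, w) \<in> Tri"
      using 0 by (rule filt_SucE)
    have "is_iso C x s v" using Tri_zero_first_iso[OF T] x' filt_0_iff by blast
    then obtain g where g: "\<guillemotleft>v : x \<rightarrow> s\<guillemotright>" "\<guillemotleft>g : s \<rightarrow> x\<guillemotright>" "v \<cdot> g = Ident C s" by (rule is_isoE)
    then have "g \<noteq> null s x"
      using brick_nonzero[OF s] S_Obj[OF s] is_zero_object_iff comp_null_right by metis
    then show ?case using s g by blast
  next
    case (Suc n)
    obtain x' s u v w where x': "filt (Suc n) x'" and s: "s \<in> S" and T: "(x', x, s, u, v, w) \<in> Tri"
      using Suc.prems by (rule filt_SucE)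
    obtain t f where t: "t \<in> S" and f: "\<guillemotleft>f : t \<rightarrow> x'\<guillemotright>" "f \<noteq> null t x'"
      using Suc.IH[OF x'] by blast
    then have "u \<cdot> f \<noteq> null t x"
      using Tri_mono[OF T S_subset_\<A>[OF s] S_subset_\<A>[OF t]] by blast
    then show ?case using t arr_comp[OF f(1) Tri_arr(1)[OF T]] by blast
  qed
  then show ?thesis using that by blast
qed

section \<open>Image factorizations\<close>

text \<open>
  The conclusion concerns a given cone \<open>c\<close> because in the induction step \<open>c\<close> is at the same time a
  cone of \<open>f\<close> and of the map induced by \<open>f\<close> on a quotient of \<open>x\<close>.
\<close>

lemma inflation_or_kills_brick:
  assumes "filt n x" "y \<in> \<A>" "(x, y, c, f, v, w) \<in> Tri"
  shows "c \<in> \<A> \<or> (\<exists>s\<in>S. \<exists>g. \<guillemotleft>g : s \<rightarrow> x\<guillemotright> \<and> g \<noteq> null s x \<and> f \<cdot> g = null s y)"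
  using assms
proof (induction n arbitrary: x y c f v w)
  case 0
  then show ?case
    using \<A>_isomorphic Tri_zero_first_iso filt_0_iff isomorphic_def by metis
next
  case (Suc n)
  note T = Suc.prems(3)
  note tr = Tri_arr[OF T]
  obtain s g where s: "s \<in> S" and g: "\<guillemotleft>g : s \<rightarrow> x\<guillemotright>" "g \<noteq> null s x"
    using brick_subobject[OF Suc.prems(1)] .
  show ?case
  proof (cases "f \<cdot> g = null s y")
    case True
    then show ?thesis using s g by blast
  next
    case False
    obtain x' i i' where x': "filt n x'" and Tg: "(s, x, x', g, i, i') \<in> Tri"
      using brick_cone[OF Suc.prems(1) s g] by blast
    note trg = Tri_arr[OF Tg]
    obtain m where m: "filt m y" using Suc.prems(2) \<A>_def by blast
    obtain m' y' l l' where m': "filt m' y'" and Tfg: "(s, y, y', f \<cdot> g, l, l') \<in> Tri"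
      using brick_cone[OF m s arr_comp[OF g(1) tr(1)] False] .
    have y': "y' \<in> \<A>" using m' \<A>_def by blast
    \<comment> \<open>\<open>f\<close> and the map \<open>f'\<close> that it induces on the quotients by \<open>s\<close> have the same cone.\<close>
    obtain f' q where T': "(x', y', c, f', q, susm i \<cdot> w) \<in> Tri"
      using Tri_octahedral[OF Tg T Tfg] by blast
    note tr' = Tri_arr[OF T']
    from Suc.IH[OF x' y' T'] show ?thesis
    proof
      assume "\<exists>t\<in>S. \<exists>h. \<guillemotleft>h : t \<rightarrow> x'\<guillemotright> \<and> h \<noteq> null t x' \<and> f' \<cdot> h = null t y'"
      then obtain t h where t: "t \<in> S" and h: "\<guillemotleft>h : t \<rightarrow> x'\<guillemotright>" "h \<noteq> null t x'" "f' \<cdot> h = null t y'"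
        by blast
      have tO: "t \<in> Obj C" using S_Obj[OF t] .
      \<comment> \<open>Since \<open>f'\<close> kills \<open>h\<close>, the suspension of \<open>h\<close> comes from the common cone \<open>c\<close>;
        from there it maps on to the suspension of \<open>x\<close>, in the part killed by \<open>f\<close>.\<close>
      have "susm f' \<cdot> susm h = null (sus t) (sus y')"
        using susm_comp[OF h(1) tr'(1)] h(3) tO tr' by simp
      then obtain m where m: "\<guillemotleft>m : sus t \<rightarrow> c\<guillemotright>" "(susm i \<cdot> w) \<cdot> m = susm h"
        using Tri_factor_left_sus[OF T' arr_susm[OF h(1)]] by blast
      have wm: "\<guillemotleft>w \<cdot> m : sus t \<rightarrow> sus x\<guillemotright>" using m(1) tr(3) by blast
      obtain k where k: "\<guillemotleft>k : t \<rightarrow> x\<guillemotright>" "susm k = w \<cdot> m"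
        using susm_full[OF wm tO tr(4)] .
      have "susm (i \<cdot> k) = susm h"
        using susm_comp[OF k(1) trg(2)] k(2) m(2) assoc[OF m(1) tr(3) arr_susm[OF trg(2)]] by simp
      then have "i \<cdot> k = h" using susm_faithful arr_comp[OF k(1) trg(2)] h(1) by blast
      then have k0: "k \<noteq> null t x" using h(2) comp_null_right[OF trg(2) tO] by blast
      have "susm (f \<cdot> k) = null (sus t) (sus y)"
        using susm_comp[OF k(1) tr(1)] k(2) assoc[OF m(1) tr(3) arr_susm[OF tr(1)]]
          Tri_comp_null(3)[OF T] comp_null_left[OF m(1) sus_Obj[OF tr(5)]] by simp
      then have "f \<cdot> k = null t y" using susm_eq_null arr_comp[OF k(1) tr(1)] by blast
      with k0 show ?thesis using t k(1) by blast
    qed blast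
  qed
qed

text \<open>
  Every map in \<open>\<A>\<close> factors through an image: as long as it is not the first map of a triangle in
  \<open>\<A>\<close>, it factors through the quotient by an object of \<open>S\<close>, which has a shorter filtration.
\<close>

lemma image_factorization:
  assumes "x \<in> \<A>" "y \<in> \<A>" "\<guillemotleft>f : x \<rightarrow> y\<guillemotright>"
  obtains k i c \<kappa> d \<kappa>' j \<gamma> \<gamma>' where "k \<in> \<A>" "i \<in> \<A>" "c \<in> \<A>"
    "(k, x, i, \<kappa>, d, \<kappa>') \<in> Tri" "(i, y, c, j, \<gamma>, \<gamma>') \<in> Tri" "f = j \<cdot> d"
proof -
  obtain n where "filt n x" using assms(1) \<A>_def by blast
  then have "\<exists>k i c \<kappa> d \<kappa>' j \<gamma> \<gamma>'. k \<in> \<A> \<and> i \<in> \<A> \<and> c \<in> \<A> \<and>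
      (k, x, i, \<kappa>, d, \<kappa>') \<in> Tri \<and> (i, y, c, j, \<gamma>, \<gamma>') \<in> Tri \<and> f = j \<cdot> d"
    using assms(3)
  proof (induction n arbitrary: x f rule: less_induct)
    case (less n)
    have x: "x \<in> \<A>" using less.prems(1) \<A>_def by blast
    obtain c v w where T: "(x, y, c, f, v, w) \<in> Tri" using Tri_complete_arr[OF less.prems(2)] .
    from inflation_or_kills_brick[OF less.prems(1) assms(2) T] show ?case
    proof
      assume c: "c \<in> \<A>"
      obtain z where z: "is_zero_object C z" using ex_zero_object by blast
      have "f = f \<cdot> Ident C x" using less.prems(2) by simp
      then show ?thesis
        using c x zero_in_\<A>[OF z] T Tri_zero_first[OF \<A>_Obj[OF x] z] by blast
    next
      assume "\<exists>s\<in>S. \<exists>g. \<guillemotleft>g : s \<rightarrow> x\<guillemotright> \<and> g \<noteq> null s x \<and> f \<cdot> g = null s y"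
      then obtain s g where s: "s \<in> S" and g: "\<guillemotleft>g : s \<rightarrow> x\<guillemotright>" "g \<noteq> null s x" "f \<cdot> g = null s y"
        by blast
      obtain m x' p p' where m: "n = Suc m" "filt m x'" and Tg: "(s, x, x', g, p, p') \<in> Tri"
        using brick_cone[OF less.prems(1) s g(1,2)] .
      obtain f' where f': "\<guillemotleft>f' : x' \<rightarrow> y\<guillemotright>" "f' \<cdot> p = f"
        using Tri_factor_right[OF Tg less.prems(2) g(3)] .
      obtain k i b \<kappa> d \<kappa>' j \<gamma> \<gamma>' where A: "k \<in> \<A>" "i \<in> \<A>" "b \<in> \<A>"
        and Td: "(k, x', i, \<kappa>, d, \<kappa>') \<in> Tri" and Tj: "(i, y, b, j, \<gamma>, \<gamma>') \<in> Tri" and eq: "f' = j \<cdot> d"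
        using less.IH[of m x' f'] m f'(1) by blast
      have "\<guillemotleft>d \<cdot> p : x \<rightarrow> i\<guillemotright>" using Tri_arr(2)[OF Tg] Tri_arr(2)[OF Td] by blast
      then obtain l \<mu> \<mu>' where Tl: "(l, x, i, \<mu>, d \<cdot> p, \<mu>') \<in> Tri" using Tri_fibre by blast
      obtain p1 p2 p3 where "(s, l, k, p1, p2, p3) \<in> Tri"
        using fibre_of_composite[OF Tg Td Tl] .
      then have "l \<in> \<A>" using \<A>_extension_closed S_subset_\<A>[OF s] A(1) by blast
      moreover have "f = j \<cdot> (d \<cdot> p)"
        using f'(2) eq assoc[OF Tri_arr(2)[OF Tg] Tri_arr(2)[OF Td] Tri_arr(1)[OF Tj]] by simp
      ultimately show ?thesis using A Tl Tj by blast
    qed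
  qed
  then show ?thesis using that by blast
qed

end
section \<open>The extension closure as an abelian category\<close>

lemma full_subcategory_simps [simp]:
  "Obj (full_subcategory C A) = A" "Hom (full_subcategory C A) = Hom C"
  "Comp (full_subcategory C A) = Comp C" "Ident (full_subcategory C A) = Ident C"
  by (simp_all add: full_subcategory_def)

context orthogonal_bricks
begin

abbreviation \<D> :: "('o, 'k, 'm) cat" where
  "\<D> \<equiv> full_subcategory C \<A>"

lemma \<D>_preadditive: "preadditive_category \<D>"
  by (intro preadditive_category.intro category.intro preadditive_category_axioms.intro;
      unfold full_subcategory_simps)
    ((rule ident_closed[OF \<A>_Obj] comp_closed[OF \<A>_Obj \<A>_Obj \<A>_Obj]
        comp_assoc[OF \<A>_Obj \<A>_Obj \<A>_Obj \<A>_Obj] ident_left[OF \<A>_Obj \<A>_Obj]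
        ident_right[OF \<A>_Obj \<A>_Obj] hom_abelian_group[OF \<A>_Obj \<A>_Obj]
        comp_add_right[OF \<A>_Obj \<A>_Obj \<A>_Obj] comp_add_left[OF \<A>_Obj \<A>_Obj \<A>_Obj];
      assumption)+)

lemma zero_object_\<D>_iff: "is_zero_object \<D> z \<longleftrightarrow> is_zero_object C z"
  using preadditive_category.is_zero_object_iff[OF \<D>_preadditive] is_zero_object_iff zero_in_\<A> \<A>_Obj
  by auto

lemma is_iso_\<D>_iff: "is_iso \<D> x y f \<longleftrightarrow> x \<in> \<A> \<and> y \<in> \<A> \<and> is_iso C x y f"
  by (auto simp: is_iso_def \<A>_Obj)

lemma \<A>_arr: "\<lbrakk>x \<in> \<A>; y \<in> \<A>\<rbrakk> \<Longrightarrow> f \<in> mor C x y \<longleftrightarrow> \<guillemotleft>f : x \<rightarrow> y\<guillemotright>"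
  by (simp add: arr_def \<A>_Obj)

lemma is_mono_\<D>_cancel:
  assumes "is_mono \<D> x y f" "t \<in> \<A>" "\<guillemotleft>g : t \<rightarrow> x\<guillemotright>" "f \<cdot> g = null t y"
  shows "g = null t x"
proof -
  have xy: "x \<in> \<A>" "y \<in> \<A>" and f: "\<guillemotleft>f : x \<rightarrow> y\<guillemotright>" using assms(1) by (auto simp: is_mono_def \<A>_arr)
  have "f \<cdot> g = f \<cdot> null t x" using assms(4) comp_null_right[OF f \<A>_Obj[OF assms(2)]] by simp
  then show ?thesis
    using assms(1-3) arr_null[OF \<A>_Obj[OF assms(2)] \<A>_Obj[OF xy(1)]] by (auto simp: is_mono_def arr_def)
qed

lemma is_epi_\<D>_cancel:
  assumes "is_epi \<D> x y f" "t \<in> \<A>" "\<guillemotleft>g : y \<rightarrow> t\<guillemotright>" "g \<cdot> f = null x t"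
  shows "g = null y t"
proof -
  have xy: "x \<in> \<A>" "y \<in> \<A>" and f: "\<guillemotleft>f : x \<rightarrow> y\<guillemotright>" using assms(1) by (auto simp: is_epi_def \<A>_arr)
  have "g \<cdot> f = null y t \<cdot> f" using assms(4) comp_null_left[OF f \<A>_Obj[OF assms(2)]] by simp
  then show ?thesis
    using assms(1-3) arr_null[OF \<A>_Obj[OF xy(2)] \<A>_Obj[OF assms(2)]] by (auto simp: is_epi_def arr_def)
qed

lemma Tri_mono_cancel:
  assumes "(x, y, z, u, v, w) \<in> Tri" "z \<in> \<A>" "t \<in> \<A>"
    and gh: "\<guillemotleft>g : t \<rightarrow> x\<guillemotright>" "\<guillemotleft>h : t \<rightarrow> x\<guillemotright>" "u \<cdot> g = u \<cdot> h"
  shows "g = h"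
proof -
  obtain d where d: "\<guillemotleft>d : t \<rightarrow> x\<guillemotright>" "d = null t x \<longleftrightarrow> g = h"
    and "\<And>z k. \<guillemotleft>k : x \<rightarrow> z\<guillemotright> \<Longrightarrow> k \<cdot> d = null t z \<longleftrightarrow> k \<cdot> g = k \<cdot> h"
    using difference[OF gh(1,2)] by metis
  then have "u \<cdot> d = null t y" using gh(3) Tri_arr(1)[OF assms(1)] by blast
  then show ?thesis using Tri_mono[OF assms(1-3) d(1)] d(2) by blast
qed

lemma Tri_epi_cancel:
  assumes "(x, y, z, u, v, w) \<in> Tri" "x \<in> \<A>" "t \<in> \<A>"
    and gh: "\<guillemotleft>g : z \<rightarrow> t\<guillemotright>" "\<guillemotleft>h : z \<rightarrow> t\<guillemotright>" "g \<cdot> v = h \<cdot> v"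
  shows "g = h"
proof -
  obtain d where d: "\<guillemotleft>d : z \<rightarrow> t\<guillemotright>" "d = null z t \<longleftrightarrow> g = h"
    and "\<And>y k. \<guillemotleft>k : y \<rightarrow> z\<guillemotright> \<Longrightarrow> d \<cdot> k = null y t \<longleftrightarrow> g \<cdot> k = h \<cdot> k"
    using difference[OF gh(1,2)] by metis
  then have "d \<cdot> v = null y t" using gh(3) Tri_arr(2)[OF assms(1)] by blast
  then show ?thesis using Tri_epi[OF assms(1-3) d(1)] d(2) by blast
qed

text \<open>
  The kernel is stated for a composite \<open>j \<cdot> v\<close> with \<open>j\<close> monic and the cokernel for a composite
  \<open>u \<cdot> e\<close> with \<open>e\<close> epic, so that both apply to the two halves of an image factorization.
\<close>

lemma Tri_kernel:
  assumes T: "(x, y, z, u, v, w) \<in> Tri" and A: "x \<in> \<A>" "y \<in> \<A>" "z \<in> \<A>" "z' \<in> \<A>"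
    and j: "\<guillemotleft>j : z \<rightarrow> z'\<guillemotright>"
    and mono: "\<And>t g. \<lbrakk>t \<in> \<A>; \<guillemotleft>g : t \<rightarrow> z\<guillemotright>; j \<cdot> g = null t z'\<rbrakk> \<Longrightarrow> g = null t z"
  shows "is_kernel \<D> y z' (j \<cdot> v) x u"
proof -
  note tr = Tri_arr[OF T]
  have jv: "\<guillemotleft>j \<cdot> v : y \<rightarrow> z'\<guillemotright>" using j tr by blast
  have "(j \<cdot> v) \<cdot> u = null x z'"
    using assoc[OF tr(1,2) j] Tri_comp_null(1)[OF T] comp_null_right[OF j tr(4)] by simp
  moreover have "\<exists>!h. h \<in> mor C t x \<and> u \<cdot> h = g"
    if t: "t \<in> \<A>" and g': "g \<in> mor C t y" and 0: "(j \<cdot> v) \<cdot> g = null t z'" for t g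
  proof -
    have g: "\<guillemotleft>g : t \<rightarrow> y\<guillemotright>" using g' t A \<A>_arr by blast
    have "v \<cdot> g = null t z" using mono[OF t arr_comp[OF g tr(2)]] assoc[OF g tr(2) j] 0 by simp
    then obtain h where "\<guillemotleft>h : t \<rightarrow> x\<guillemotright>" "u \<cdot> h = g" using Tri_factor_left[OF T g] by blast
    then show ?thesis
      using Tri_mono_cancel[OF T A(3) t] \<A>_arr[OF t A(1)] by (intro ex1I[of _ h]) auto
  qed
  ultimately show ?thesis
    unfolding is_kernel_def using A jv tr by (auto simp: arr_def)
qed

lemma Tri_cokernel:
  assumes T: "(x, y, z, u, v, w) \<in> Tri" and A: "x' \<in> \<A>" "x \<in> \<A>" "y \<in> \<A>" "z \<in> \<A>"
    and e: "\<guillemotleft>e : x' \<rightarrow> x\<guillemotright>"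
    and epi: "\<And>t g. \<lbrakk>t \<in> \<A>; \<guillemotleft>g : x \<rightarrow> t\<guillemotright>; g \<cdot> e = null x' t\<rbrakk> \<Longrightarrow> g = null x t"
  shows "is_cokernel \<D> x' y (u \<cdot> e) z v"
proof -
  note tr = Tri_arr[OF T]
  have ue: "\<guillemotleft>u \<cdot> e : x' \<rightarrow> y\<guillemotright>" using e tr by blast
  have "v \<cdot> (u \<cdot> e) = null x' z"
    using assoc[OF e tr(1,2)] Tri_comp_null(1)[OF T] comp_null_left[OF e tr(6)] by simp
  moreover have "\<exists>!h. h \<in> mor C z t \<and> h \<cdot> v = g"
    if t: "t \<in> \<A>" and g': "g \<in> mor C y t" and 0: "g \<cdot> (u \<cdot> e) = null x' t" for t g
  proof -
    have g: "\<guillemotleft>g : y \<rightarrow> t\<guillemotright>" using g' t A \<A>_arr by blast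
    have "g \<cdot> u = null x t" using epi[OF t arr_comp[OF tr(1) g]] assoc[OF e tr(1) g] 0 by simp
    then obtain h where "\<guillemotleft>h : z \<rightarrow> t\<guillemotright>" "h \<cdot> v = g" using Tri_factor_right[OF T g] by blast
    then show ?thesis
      using Tri_epi_cancel[OF T A(2) t] \<A>_arr[OF A(4) t] by (intro ex1I[of _ h]) auto
  qed
  ultimately show ?thesis
    unfolding is_cokernel_def using A ue tr by (auto simp: arr_def)
qed

lemma Tri_kernel_cokernel:
  assumes T: "(x, y, z, u, v, w) \<in> Tri" and A: "x \<in> \<A>" "y \<in> \<A>" "z \<in> \<A>"
  shows "is_kernel \<D> y z v x u" "is_cokernel \<D> x y u z v"
proof -
  note tr = Tri_arr[OF T]
  have "is_kernel \<D> y z (Ident C z \<cdot> v) x u"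
    by (rule Tri_kernel[OF T A A(3) arr_ident[OF tr(6)]]) simp
  then show "is_kernel \<D> y z v x u" using tr by simp
  have "is_cokernel \<D> x y (u \<cdot> Ident C x) z v"
    by (rule Tri_cokernel[OF T A(1) A arr_ident[OF tr(4)]]) simp
  then show "is_cokernel \<D> x y u z v" using tr by simp
qed

text \<open>
  A monomorphism kills no nonzero map, so the dichotomy for its cone leaves only one case.
\<close>

lemma is_mono_\<D>_triangle:
  assumes "is_mono \<D> x y f"
  obtains c v w where "c \<in> \<A>" "(x, y, c, f, v, w) \<in> Tri"
proof -
  have xy: "x \<in> \<A>" "y \<in> \<A>" and f: "\<guillemotleft>f : x \<rightarrow> y\<guillemotright>"
    using assms by (auto simp: is_mono_def \<A>_arr)
  obtain c v w where T: "(x, y, c, f, v, w) \<in> Tri" using Tri_complete_arr[OF f] .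
  obtain n where "filt n x" using xy \<A>_def by blast
  then have "c \<in> \<A>"
    using inflation_or_kills_brick[OF _ xy(2) T] is_mono_\<D>_cancel[OF assms] S_subset_\<A> by blast
  then show ?thesis using that T by blast
qed

text \<open>
  The cokernel \<open>c\<close> in the image factorization of an epimorphism vanishes, so the epimorphism agrees
  up to isomorphism with the first factor \<open>d\<close>.
\<close>

lemma is_epi_\<D>_triangle:
  assumes "is_epi \<D> x y f"
  obtains k u w where "k \<in> \<A>" "(k, x, y, u, f, w) \<in> Tri"
proof -
  have xy: "x \<in> \<A>" "y \<in> \<A>" and f: "\<guillemotleft>f : x \<rightarrow> y\<guillemotright>"
    using assms by (auto simp: is_epi_def \<A>_arr)
  obtain k i c \<kappa> d \<kappa>' j \<gamma> \<gamma>' where A: "k \<in> \<A>" "i \<in> \<A>" "c \<in> \<A>"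
    and Td: "(k, x, i, \<kappa>, d, \<kappa>') \<in> Tri" and Tj: "(i, y, c, j, \<gamma>, \<gamma>') \<in> Tri" and fjd: "f = j \<cdot> d"
    using image_factorization[OF xy f] .
  note td = Tri_arr[OF Td] and tj = Tri_arr[OF Tj]
  have "\<gamma> \<cdot> f = null x c"
    using assoc[OF td(2) tj(1,2)] fjd Tri_comp_null(1)[OF Tj] comp_null_left[OF td(2) tj(6)] by simp
  then have "\<gamma> = null y c" using is_epi_\<D>_cancel[OF assms A(3) tj(2)] by blast
  then have "Ident C c \<cdot> \<gamma> = null y c" using ident_l[OF tj(2)] by simp
  then have "is_zero_object C c"
    using Tri_epi[OF Tj A(2,3) arr_ident[OF tj(6)]] tj(6) is_zero_object_iff by blast
  then have "is_iso C i y j" using Tri_zero_last_iso[OF Tj] by blast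
  then obtain j' where "\<guillemotleft>j : i \<rightarrow> y\<guillemotright>" "\<guillemotleft>j' : y \<rightarrow> i\<guillemotright>" "j' \<cdot> j = Ident C i" "j \<cdot> j' = Ident C y"
    by (rule is_isoE)
  then show ?thesis using that A(1) Tri_iso_last[OF Td] fjd by blast
qed

lemma Tri_is_mono:
  assumes T: "(x, y, z, u, v, w) \<in> Tri" and A: "x \<in> \<A>" "y \<in> \<A>" "z \<in> \<A>"
  shows "is_mono \<D> x y u"
  unfolding is_mono_def using A Tri_arr(1)[OF T] Tri_mono_cancel[OF T A(3)] \<A>_arr by auto

lemma Tri_is_epi:
  assumes T: "(x, y, z, u, v, w) \<in> Tri" and A: "x \<in> \<A>" "y \<in> \<A>" "z \<in> \<A>"
  shows "is_epi \<D> y z v"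
  unfolding is_epi_def using A Tri_arr(2)[OF T] Tri_epi_cancel[OF T A(1)] \<A>_arr by auto

lemma \<A>_direct_sum:
  assumes "a \<in> \<A>" "b \<in> \<A>" "is_direct_sum C a b s"
  shows "s \<in> \<A>"
proof -
  obtain c u v w where T: "(a, s, c, u, v, w) \<in> Tri" and "isomorphic C c b"
    using direct_sum_triangle[OF assms(3)] .
  then have "c \<in> \<A>" using \<A>_isomorphic assms(2) isomorphic_sym by blast
  then show ?thesis using \<A>_extension_closed[OF T assms(1)] by blast
qed

lemma \<D>_abelian: "abelian_category \<D>"
proof -
  interpret D: preadditive_category \<D> by (rule \<D>_preadditive)
  show ?thesis
  proof
    obtain z where "is_zero_object C z" using ex_zero_object by blast
    then show "\<exists>z. is_zero_object \<D> z" using zero_object_\<D>_iff by blast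
  next
    fix a b assume "a \<in> Obj \<D>" "b \<in> Obj \<D>"
    then have ab: "a \<in> \<A>" "b \<in> \<A>" by simp_all
    then obtain s where s: "is_direct_sum C a b s" using ex_direct_sum \<A>_Obj by blast
    then have "is_direct_sum \<D> a b s"
      using ab \<A>_direct_sum[OF ab s] by (auto simp: is_direct_sum_def)
    then show "\<exists>s. is_direct_sum \<D> a b s" ..
  next
    fix x y f assume "x \<in> Obj \<D>" "y \<in> Obj \<D>" "f \<in> mor \<D> x y"
    then have xy: "x \<in> \<A>" "y \<in> \<A>" and f: "\<guillemotleft>f : x \<rightarrow> y\<guillemotright>" by (simp_all add: \<A>_arr)
    obtain k i c \<kappa> d \<kappa>' j \<gamma> \<gamma>' where A: "k \<in> \<A>" "i \<in> \<A>" "c \<in> \<A>"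
      and Td: "(k, x, i, \<kappa>, d, \<kappa>') \<in> Tri" and Tj: "(i, y, c, j, \<gamma>, \<gamma>') \<in> Tri" and fjd: "f = j \<cdot> d"
      using image_factorization[OF xy f] .
    have "is_kernel \<D> x y f k \<kappa>"
      unfolding fjd using Tri_mono[OF Tj A(3)] Tri_arr(1)[OF Tj]
      by (intro Tri_kernel[OF Td]) (use A xy in auto)
    then show "\<exists>a i. is_kernel \<D> x y f a i" by blast
    have "is_cokernel \<D> x y f c \<gamma>"
      unfolding fjd using Tri_epi[OF Td A(1)] Tri_arr(2)[OF Td]
      by (intro Tri_cokernel[OF Tj]) (use A xy in auto)
    then show "\<exists>b p. is_cokernel \<D> x y f b p" by blast
  next
    fix x y f assume f: "is_mono \<D> x y f"
    then have "x \<in> \<A>" "y \<in> \<A>" by (simp_all add: is_mono_def)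
    then show "\<exists>z g. is_kernel \<D> y z g x f"
      using is_mono_\<D>_triangle[OF f] Tri_kernel_cokernel(1) by metis
  next
    fix x y f assume f: "is_epi \<D> x y f"
    then have "x \<in> \<A>" "y \<in> \<A>" by (simp_all add: is_epi_def)
    then show "\<exists>z g. is_cokernel \<D> z x g y f"
      using is_epi_\<D>_triangle[OF f] Tri_kernel_cokernel(2) by metis
  qed
qed

lemma is_kernel_\<D>_factor:
  assumes "is_kernel \<D> x y f a i" "t \<in> \<A>" "\<guillemotleft>g : t \<rightarrow> x\<guillemotright>" "f \<cdot> g = null t y"
  obtains h where "\<guillemotleft>h : t \<rightarrow> a\<guillemotright>" "i \<cdot> h = g"
proof -
  have "a \<in> \<A>" "\<exists>h. h \<in> mor C t a \<and> i \<cdot> h = g"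
    using assms unfolding is_kernel_def arr_def full_subcategory_simps by blast+
  then show ?thesis using that \<A>_arr[OF assms(2)] by blast
qed

lemma is_cokernel_\<D>_factor:
  assumes "is_cokernel \<D> x y f b p" "t \<in> \<A>" "\<guillemotleft>g : y \<rightarrow> t\<guillemotright>" "g \<cdot> f = null x t"
  obtains h where "\<guillemotleft>h : b \<rightarrow> t\<guillemotright>" "h \<cdot> p = g"
proof -
  have "b \<in> \<A>" "\<exists>h. h \<in> mor C b t \<and> h \<cdot> p = g"
    using assms unfolding is_cokernel_def arr_def full_subcategory_simps by blast+
  then show ?thesis using that \<A>_arr[OF _ assms(2)] by blast
qed

lemma short_exact_if_Tri:
  assumes T: "(x, y, z, f, g, h) \<in> Tri" and A: "x \<in> \<A>" "y \<in> \<A>" "z \<in> \<A>"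
  shows "short_exact \<D> x y z f g"
  unfolding short_exact_def is_image_def
  using Tri_is_mono[OF T A] Tri_is_epi[OF T A] Tri_kernel_cokernel[OF T A] by blast

text \<open>
  In a short exact sequence both maps belong to triangles in \<open>\<A>\<close>, one starting with \<open>f\<close> and one
  ending with \<open>g\<close>. Exactness makes \<open>f\<close> and the fibre \<open>\<kappa>\<close> of \<open>g\<close> factor through each other, which
  identifies the two triangles.
\<close>

lemma short_triangle_if_short_exact:
  assumes "short_exact \<D> x y z f g"
  shows "short_triangle Tri x y z f g"
proof -
  have f_mono: "is_mono \<D> x y f" and g_epi: "is_epi \<D> y z g"
    using assms by (auto simp: short_exact_def)
  obtain a i b p where coker: "is_cokernel \<D> x y f b p" and ker_p: "is_kernel \<D> y b p a i"
    and ker_g: "is_kernel \<D> y z g a i"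
    using assms by (auto simp: short_exact_def is_image_def)
  have A: "x \<in> \<A>" "y \<in> \<A>" "z \<in> \<A>" "a \<in> \<A>" "b \<in> \<A>"
    using coker ker_p ker_g by (auto simp: is_kernel_def is_cokernel_def)
  have f: "\<guillemotleft>f : x \<rightarrow> y\<guillemotright>" and g: "\<guillemotleft>g : y \<rightarrow> z\<guillemotright>" and i: "\<guillemotleft>i : a \<rightarrow> y\<guillemotright>" and p: "\<guillemotleft>p : y \<rightarrow> b\<guillemotright>"
    and pf: "p \<cdot> f = null x b" and pi: "p \<cdot> i = null a b" and gi: "g \<cdot> i = null a z"
    using coker ker_p ker_g A by (auto simp: is_kernel_def is_cokernel_def \<A>_arr)
  obtain c v w where c: "c \<in> \<A>" and Tf: "(x, y, c, f, v, w) \<in> Tri"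
    using is_mono_\<D>_triangle[OF f_mono] .
  obtain k \<kappa> h where k: "k \<in> \<A>" and Tg: "(k, y, z, \<kappa>, g, h) \<in> Tri"
    using is_epi_\<D>_triangle[OF g_epi] .
  note tf = Tri_arr[OF Tf] and tg = Tri_arr[OF Tg]
  obtain \<phi>' where \<phi>': "\<guillemotleft>\<phi>' : x \<rightarrow> a\<guillemotright>" "i \<cdot> \<phi>' = f"
    using is_kernel_\<D>_factor[OF ker_p A(1) f pf] .
  have "g \<cdot> f = null x z"
    using assoc[OF \<phi>'(1) i g] \<phi>'(2) gi comp_null_left[OF \<phi>'(1) tg(6)] by simp
  then obtain \<phi> where \<phi>: "\<guillemotleft>\<phi> : x \<rightarrow> k\<guillemotright>" "\<kappa> \<cdot> \<phi> = f"
    using Tri_factor_left[OF Tg f] by blast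
  obtain \<psi>' where \<psi>': "\<guillemotleft>\<psi>' : k \<rightarrow> a\<guillemotright>" "i \<cdot> \<psi>' = \<kappa>"
    using is_kernel_\<D>_factor[OF ker_g k tg(1) Tri_comp_null(1)[OF Tg]] .
  obtain r where r: "\<guillemotleft>r : b \<rightarrow> c\<guillemotright>" "r \<cdot> p = v"
    using is_cokernel_\<D>_factor[OF coker c tf(2) Tri_comp_null(1)[OF Tf]] .
  have "v \<cdot> i = null a c"
    using assoc[OF i p r(1)] r(2) pi comp_null_right[OF r(1) arr_dom[OF i]] by simp
  then have "v \<cdot> \<kappa> = null k c"
    using assoc[OF \<psi>'(1) i tf(2)] \<psi>'(2) comp_null_left[OF \<psi>'(1) tf(6)] by simp
  then obtain \<psi> where \<psi>: "\<guillemotleft>\<psi> : k \<rightarrow> x\<guillemotright>" "f \<cdot> \<psi> = \<kappa>"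
    using Tri_factor_left[OF Tf tg(1)] by blast
  have "\<kappa> \<cdot> (\<phi> \<cdot> \<psi>) = \<kappa> \<cdot> Ident C k"
    using assoc[OF \<psi>(1) \<phi>(1) tg(1)] \<phi>(2) \<psi>(2) tg(1) by simp
  then have 1: "\<phi> \<cdot> \<psi> = Ident C k"
    using Tri_mono_cancel[OF Tg A(3) k arr_comp[OF \<psi>(1) \<phi>(1)] arr_ident[OF tg(4)]] by blast
  have "f \<cdot> (\<psi> \<cdot> \<phi>) = f \<cdot> Ident C x"
    using assoc[OF \<phi>(1) \<psi>(1) f] \<phi>(2) \<psi>(2) f by simp
  then have 2: "\<psi> \<cdot> \<phi> = Ident C x"
    using Tri_mono_cancel[OF Tf c A(1) arr_comp[OF \<phi>(1) \<psi>(1)] arr_ident[OF tf(4)]] by blast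
  show ?thesis
    using Tri_iso_first[OF Tg \<psi>(1) \<phi>(1) 1 2] \<phi>(2) unfolding short_triangle_def by auto
qed

text \<open>
  A direct summand \<open>a\<close> of \<open>s\<close> is the image of an idempotent of \<open>s\<close>, and this idempotent also splits
  over the kernel, taken in \<open>\<A>\<close>, of the complementary idempotent.
\<close>

lemma \<A>_summand:
  assumes ds: "is_direct_sum C a b s" and s: "s \<in> \<A>"
  shows "a \<in> \<A>"
proof -
  obtain i j p q where i: "\<guillemotleft>i : a \<rightarrow> s\<guillemotright>" and j: "\<guillemotleft>j : b \<rightarrow> s\<guillemotright>" and p: "\<guillemotleft>p : s \<rightarrow> a\<guillemotright>" and q: "\<guillemotleft>q : s \<rightarrow> b\<guillemotright>"
    and pi: "p \<cdot> i = Ident C a" and qi: "q \<cdot> i = null a b"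
    and sum: "(i \<cdot> p) \<oplus>\<^bsub>Hom C s s\<^esub> (j \<cdot> q) = Ident C s"
    using ds unfolding is_direct_sum_def arr_def by metis
  have ip: "\<guillemotleft>i \<cdot> p : s \<rightarrow> s\<guillemotright>" and jq: "\<guillemotleft>j \<cdot> q : s \<rightarrow> s\<guillemotright>" using i j p q by auto
  have O: "a \<in> Obj C" "b \<in> Obj C" "s \<in> Obj C" using i j arr_def by auto
  obtain k \<kappa> where ker: "is_kernel \<D> s s (j \<cdot> q) k \<kappa>"
    using abelian_category.ex_kernel[OF \<D>_abelian, of s s "j \<cdot> q"] s jq by (auto simp: arr_def)
  have k: "k \<in> \<A>" and \<kappa>: "\<guillemotleft>\<kappa> : k \<rightarrow> s\<guillemotright>" and 0: "(j \<cdot> q) \<cdot> \<kappa> = null k s"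
    using ker by (auto simp: is_kernel_def \<A>_arr)
  have "q \<cdot> (i \<cdot> p) = null s b" using assoc[OF p i q] qi comp_null_left[OF p O(2)] by simp
  then have "(j \<cdot> q) \<cdot> (i \<cdot> p) = null s s"
    using assoc[OF ip q j] comp_null_right[OF j O(3)] by simp
  then obtain r where r: "\<guillemotleft>r : s \<rightarrow> k\<guillemotright>" "\<kappa> \<cdot> r = i \<cdot> p"
    using is_kernel_\<D>_factor[OF ker s ip] by blast
  have "\<kappa> = ((i \<cdot> p) \<oplus>\<^bsub>Hom C s s\<^esub> (j \<cdot> q)) \<cdot> \<kappa>" using sum \<kappa> by simp
  also have "\<dots> = ((i \<cdot> p) \<cdot> \<kappa>) \<oplus>\<^bsub>Hom C k s\<^esub> ((j \<cdot> q) \<cdot> \<kappa>)"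
    using ip jq \<kappa> by (intro comp_add_left) (auto simp: arr_def)
  also have "\<dots> = (i \<cdot> p) \<cdot> \<kappa>"
  proof -
    interpret abelian_group "Hom C k s" using hom_abelian_group \<A>_Obj k s by blast
    show ?thesis using 0 arr_comp[OF \<kappa> ip] by (simp add: arr_def)
  qed
  finally have ip\<kappa>: "(i \<cdot> p) \<cdot> \<kappa> = \<kappa>" by simp
  have "\<kappa> \<cdot> (r \<cdot> \<kappa>) = \<kappa>" using assoc[OF \<kappa> r(1) \<kappa>] r(2) ip\<kappa> by simp
  moreover have "\<exists>!h. h \<in> mor C k k \<and> \<kappa> \<cdot> h = \<kappa>"
    using ker k \<kappa> 0 unfolding is_kernel_def arr_def full_subcategory_simps by blast
  moreover have "r \<cdot> \<kappa> \<in> mor C k k" "Ident C k \<in> mor C k k" "\<kappa> \<cdot> Ident C k = \<kappa>"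
    using arr_comp[OF \<kappa> r(1)] arr_ident[OF arr_dom[OF \<kappa>]] \<kappa> by (auto simp: arr_def)
  ultimately have r\<kappa>: "r \<cdot> \<kappa> = Ident C k" by blast
  have p\<kappa>: "\<guillemotleft>p \<cdot> \<kappa> : k \<rightarrow> a\<guillemotright>" and ri: "\<guillemotleft>r \<cdot> i : a \<rightarrow> k\<guillemotright>" using p \<kappa> r i by auto
  have "(p \<cdot> \<kappa>) \<cdot> (r \<cdot> i) = Ident C a"
  proof -
    have "(p \<cdot> \<kappa>) \<cdot> (r \<cdot> i) = p \<cdot> ((\<kappa> \<cdot> r) \<cdot> i)"
      using assoc[OF ri \<kappa> p] assoc[OF i r(1) \<kappa>] by simp
    also have "\<dots> = p \<cdot> (i \<cdot> (p \<cdot> i))" using r(2) assoc[OF i p i] by simp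
    finally show ?thesis using pi i by simp
  qed
  moreover have "(r \<cdot> i) \<cdot> (p \<cdot> \<kappa>) = Ident C k"
  proof -
    have "(r \<cdot> i) \<cdot> (p \<cdot> \<kappa>) = r \<cdot> ((i \<cdot> p) \<cdot> \<kappa>)"
      using assoc[OF p\<kappa> i r(1)] assoc[OF \<kappa> p i] by simp
    then show ?thesis using ip\<kappa> r\<kappa> by simp
  qed
  ultimately have "is_iso C k a (p \<cdot> \<kappa>)" using is_isoI[OF p\<kappa> ri] by blast
  then show ?thesis using \<A>_isomorphic[OF k] isomorphicI by blast
qed

lemma is_direct_sum_swap:
  assumes "is_direct_sum C a b s"
  shows "is_direct_sum C b a s"
proof -
  obtain i j p q where i: "i \<in> mor C a s" and j: "j \<in> mor C b s" and p: "p \<in> mor C s a"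
    and q: "q \<in> mor C s b"
    and eq: "p \<cdot> i = Ident C a" "q \<cdot> j = Ident C b" "q \<cdot> i = null a b" "p \<cdot> j = null b a"
    and sum: "(i \<cdot> p) \<oplus>\<^bsub>Hom C s s\<^esub> (j \<cdot> q) = Ident C s"
    and O: "a \<in> Obj C" "b \<in> Obj C" "s \<in> Obj C"
    using assms unfolding is_direct_sum_def by metis
  interpret abelian_group "Hom C s s" using hom_abelian_group O by blast
  have "(j \<cdot> q) \<oplus>\<^bsub>Hom C s s\<^esub> (i \<cdot> p) = Ident C s"
    using sum a_comm[of "i \<cdot> p" "j \<cdot> q"] comp_closed[OF O(3,1,3) p i] comp_closed[OF O(3,2,3) q j] by simp
  then show ?thesis unfolding is_direct_sum_def using i j p q eq O by blast
qed

lemma \<A>_proper_abelian: "proper_abelian_subcategory C Tri \<A>"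
proof -
  have "additive_subcategory C \<A>"
    unfolding additive_subcategory_def
    using \<A>_Obj \<A>_isomorphic zero_in_\<A> \<A>_direct_sum \<A>_summand is_direct_sum_swap by blast
  moreover have "short_exact \<D> x y z f g \<longleftrightarrow> short_triangle Tri x y z f g"
    if "x \<in> \<A>" "y \<in> \<A>" "z \<in> \<A>" for x y z f g
    using short_exact_if_Tri[OF _ that] short_triangle_if_short_exact
    unfolding short_triangle_def by blast
  ultimately show ?thesis
    unfolding proper_abelian_subcategory_def using \<D>_abelian by blast
qed


section \<open>Simple objects and finite length\<close>

lemma \<A>_brick_subobject:
  assumes "x \<in> \<A>" "\<not> is_zero_object C x"
  obtains s f where "s \<in> S" "\<guillemotleft>f : s \<rightarrow> x\<guillemotright>" "f \<noteq> null s x"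
proof -
  obtain n where n: "filt n x" using assms(1) \<A>_def by blast
  show ?thesis
  proof (cases n)
    case 0
    then show ?thesis using n assms(2) filt_0_iff by blast
  next
    case (Suc m)
    then show ?thesis using n brick_subobject that by blast
  qed
qed

text \<open>
  A nonzero subobject of \<open>s\<close> receives a nonzero map from some \<open>t\<close> in \<open>S\<close>. The resulting nonzero map
  \<open>t \<rightarrow> s\<close> is invertible by Schur's lemma, so the subobject is everything.
\<close>

lemma is_simple_if_isomorphic_brick:
  assumes s: "s \<in> S" and iso: "isomorphic C x s"
  shows "is_simple \<D> x"
proof -
  have x: "x \<in> \<A>" using \<A>_isomorphic[OF S_subset_\<A>[OF s] isomorphic_sym[OF iso]] .
  obtain e where "is_iso C x s e" using iso isomorphic_def by metis
  then obtain e' where e: "\<guillemotleft>e : x \<rightarrow> s\<guillemotright>" "\<guillemotleft>e' : s \<rightarrow> x\<guillemotright>" "e' \<cdot> e = Ident C x" "is_iso C x s e"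
    by (meson is_isoE)
  have "\<not> is_zero_object C x"
    using zero_object_iso e(4) brick_nonzero[OF s] by blast
  moreover have "is_zero_object C y \<or> is_iso C y x i" if i_mono: "is_mono \<D> y x i" for y i
  proof (rule disjCI)
    assume "\<not> is_iso C y x i"
    have y: "y \<in> \<A>" and i: "\<guillemotleft>i : y \<rightarrow> x\<guillemotright>" using i_mono by (auto simp: is_mono_def \<A>_arr)
    show "is_zero_object C y"
    proof (rule ccontr)
      assume "\<not> is_zero_object C y"
      then obtain t f where t: "t \<in> S" and f: "\<guillemotleft>f : t \<rightarrow> y\<guillemotright>" "f \<noteq> null t y"
        using \<A>_brick_subobject[OF y] by blast
      have tO: "t \<in> Obj C" using S_Obj[OF t] .
      have if_: "\<guillemotleft>i \<cdot> f : t \<rightarrow> x\<guillemotright>" using i f by blast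
      have "i \<cdot> f \<noteq> null t x" using is_mono_\<D>_cancel[OF i_mono S_subset_\<A>[OF t]] f by blast
      then have ne: "e \<cdot> (i \<cdot> f) \<noteq> null t s"
        using assoc[OF if_ e(1,2)] e(3) comp_null_right[OF e(2) tO] ident_l[OF if_] by auto
      have eif: "\<guillemotleft>e \<cdot> (i \<cdot> f) : t \<rightarrow> s\<guillemotright>" using if_ e by blast
      have "t = s" using brick_orth[OF t s eif] ne by blast
      then have "is_iso C t s (e \<cdot> (i \<cdot> f))" using brick_iso[OF s] eif ne by simp
      then obtain m where m: "\<guillemotleft>m : s \<rightarrow> t\<guillemotright>" "(e \<cdot> (i \<cdot> f)) \<cdot> m = Ident C s"
        by (meson is_isoE)
      \<comment> \<open>So \<open>i\<close> has the right inverse \<open>h\<close>, and a monomorphism with a right inverse is invertible.\<close>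
      define h where "h = (f \<cdot> m) \<cdot> e"
      have fm: "\<guillemotleft>f \<cdot> m : s \<rightarrow> y\<guillemotright>" and h: "\<guillemotleft>h : x \<rightarrow> y\<guillemotright>" using f m e unfolding h_def by auto
      have ih: "\<guillemotleft>i \<cdot> h : x \<rightarrow> x\<guillemotright>" using i h by blast
      have ifm: "\<guillemotleft>i \<cdot> (f \<cdot> m) : s \<rightarrow> x\<guillemotright>" using i fm by blast
      have 1: "e \<cdot> (i \<cdot> (f \<cdot> m)) = Ident C s"
        using assoc[OF m(1) if_ e(1)] assoc[OF m(1) f(1) i] m(2) by simp
      have 2: "i \<cdot> (f \<cdot> m) = e'"
      proof -
        have "i \<cdot> (f \<cdot> m) = (e' \<cdot> e) \<cdot> (i \<cdot> (f \<cdot> m))" using e(3) ifm by simp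
        also have "\<dots> = e' \<cdot> (e \<cdot> (i \<cdot> (f \<cdot> m)))" using assoc[OF ifm e(1,2)] .
        finally show ?thesis using 1 e(2) by simp
      qed
      have ih_id: "i \<cdot> h = Ident C x"
        unfolding h_def using assoc[OF e(1) fm i] 2 e(3) by simp
      have "i \<cdot> (h \<cdot> i) = i \<cdot> Ident C y"
        using assoc[OF i h i] ih_id i by simp
      then have "h \<cdot> i = Ident C y"
        using i_mono y arr_comp[OF i h] arr_ident[OF arr_dom[OF i]]
        by (auto simp: is_mono_def arr_def)
      then show False using \<open>\<not> is_iso C y x i\<close> is_isoI[OF i h] ih_id by blast
    qed
  qed
  ultimately show ?thesis
    unfolding is_simple_def zero_object_\<D>_iff is_iso_\<D>_iff
    using x by (auto simp: is_mono_def)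
qed

text \<open>
  Every nonzero object of \<open>\<A>\<close> contains an object of \<open>S\<close>, because nonzero maps from \<open>S\<close> are monic.
\<close>

lemma isomorphic_brick_if_is_simple:
  assumes "is_simple \<D> x"
  shows "\<exists>s\<in>S. isomorphic C x s"
proof -
  have x: "x \<in> \<A>" "\<not> is_zero_object C x"
    using assms by (auto simp: is_simple_def zero_object_\<D>_iff)
  then obtain s f where s: "s \<in> S" and f: "\<guillemotleft>f : s \<rightarrow> x\<guillemotright>" "f \<noteq> null s x"
    using \<A>_brick_subobject by blast
  obtain n where n: "filt n x" using x \<A>_def by blast
  obtain m c v w where m: "filt m c" and T: "(s, x, c, f, v, w) \<in> Tri"
    using brick_cone[OF n s f] .
  have "c \<in> \<A>" using m \<A>_def by blast
  then have "is_mono \<D> s x f" using Tri_is_mono[OF T S_subset_\<A>[OF s] x(1)] by blast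
  then have "is_iso C s x f"
    using assms brick_nonzero[OF s] by (auto simp: is_simple_def zero_object_\<D>_iff is_iso_\<D>_iff)
  then show ?thesis using s isomorphic_sym isomorphicI by blast
qed

lemma \<A>_finite_length:
  assumes "x \<in> \<A>"
  shows "has_finite_length \<D> x"
proof -
  have "\<exists>X. is_zero_object \<D> (X 0) \<and> X n = x \<and>
     (\<forall>j<n. \<exists>s f g. is_simple \<D> s \<and> short_exact \<D> (X j) (X (Suc j)) s f g)" if "filt n x" for n x
    using that
  proof (induction rule: filt.induct)
    case (zero z)
    then show ?case using zero_object_\<D>_iff by (intro exI[of _ "\<lambda>_. z"]) simp
  next
    case (step n x s y u v w)
    obtain X where X: "is_zero_object \<D> (X 0)" "X n = x"
      "\<And>j. j < n \<Longrightarrow> \<exists>s f g. is_simple \<D> s \<and> short_exact \<D> (X j) (X (Suc j)) s f g"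
      using step.IH by blast
    have "x \<in> \<A>" "y \<in> \<A>" using step filt.step \<A>_def by blast+
    then have "short_exact \<D> x y s u v" using short_exact_if_Tri step S_subset_\<A> by blast
    moreover have "is_simple \<D> s"
      using is_simple_if_isomorphic_brick[OF step(2)] is_iso_ident[OF S_Obj[OF step(2)]]
        isomorphicI by blast
    ultimately show ?case
      using X by (intro exI[of _ "X(Suc n := y)"]) (auto simp: less_Suc_eq)
  qed
  then show ?thesis
    using assms unfolding \<A>_def has_finite_length_def by blast
qed

end

context triangulated_category
begin

text \<open>
  For \<open>w \<ge> 2\<close> the exponent \<open>-1\<close> is in the
  required range, and maps \<open>s \<rightarrow> \<Sigma>\<^sup>-\<^sup>1 t\<close> correspond to maps \<open>\<Sigma> s \<rightarrow> t\<close>.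
\<close>

lemma orthogonal_bricks_if_orthogonal_collection:
  assumes "w \<ge> 2"
    and S: "orthogonal_collection C Susp Desusp w S"
  shows "orthogonal_bricks K C Susp Desusp Tri S"
proof -
  have S_Obj: "s \<in> Obj C" if "s \<in> S" for s using S that by (auto simp: orthogonal_collection_def)
  have skew: "skew_field (End_ring C s)" if "s \<in> S" for s
    using S that by (auto simp: orthogonal_collection_def)
  show ?thesis
  proof
    show "s \<in> Obj C" if "s \<in> S" for s using S_Obj that .
    show "\<not> is_zero_object C s" if "s \<in> S" for s
      using skew_field.one_not_zero[OF skew[OF that]] by (simp add: End_ring_def is_zero_object_iff)
    show "is_iso C s s f" if "s \<in> S" "\<guillemotleft>f : s \<rightarrow> s\<guillemotright>" "f \<noteq> null s s" for s f
    proof -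
      have "f \<in> Units (End_ring C s)"
        using skew_field.Units_eq[OF skew[OF that(1)]] that(2,3) by (simp add: End_ring_def arr_def)
      then show ?thesis
        using that S_Obj by (auto simp: Units_def End_ring_def is_iso_def arr_def)
    qed
    show "f = null s t" if "s \<in> S" "t \<in> S" "\<guillemotleft>f : s \<rightarrow> t\<guillemotright>" "s \<noteq> t" for s t f
      using S that unfolding orthogonal_collection_def arr_def by blast
    show "f = null (sus s) t" if s: "s \<in> S" and t: "t \<in> S" and f: "\<guillemotleft>f : sus s \<rightarrow> t\<guillemotright>" for s t f
    proof -
      let ?D = "omap Desusp" and ?d = "amap Desusp"
      have sO: "s \<in> Obj C" and tO: "t \<in> Obj C" using s t S_Obj by auto
      have D: "?D x \<in> Obj C" if "x \<in> Obj C" for x using Desusp.omap_closed that .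
      have vanish: "g = null s (?D t)" if "\<guillemotleft>g : s \<rightarrow> ?D t\<guillemotright>" for g
      proof -
        have "(-1::int) \<in> {- w + 1..-1}" using \<open>w \<ge> 2\<close> by simp
        then have "mor C s (susp_power Susp Desusp (-1) t) = {null s (susp_power Susp Desusp (-1) t)}"
          using S s t unfolding orthogonal_collection_def by blast
        then show ?thesis using that by (simp add: susp_power_def arr_def)
      qed
      have df: "\<guillemotleft>?d f : ?D (sus s) \<rightarrow> ?D t\<guillemotright>"
        using f by (auto simp: arr_def Desusp.omap_closed Desusp.amap_closed)
      obtain \<eta> where \<eta>: "\<And>x. x \<in> Obj C \<Longrightarrow> is_iso C (?D (sus x)) x (\<eta> x)"
        and "\<And>x y f. \<guillemotleft>f : x \<rightarrow> y\<guillemotright> \<Longrightarrow> f \<cdot> \<eta> x = \<eta> y \<cdot> ?d (susm f)"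
        using nat_iso_idE[OF Desusp_Susp] by blast
      obtain \<theta> where \<theta>: "\<guillemotleft>\<eta> s : ?D (sus s) \<rightarrow> s\<guillemotright>" "\<guillemotleft>\<theta> : s \<rightarrow> ?D (sus s)\<guillemotright>"
          "\<theta> \<cdot> \<eta> s = Ident C (?D (sus s))"
        using \<eta>[OF sO] by (meson is_isoE)
      have "?d f = (?d f \<cdot> \<theta>) \<cdot> \<eta> s" using assoc[OF \<theta>(1,2) df] \<theta>(3) df by simp
      also have "\<dots> = null (?D (sus s)) (?D t)"
        using vanish[OF arr_comp[OF \<theta>(2) df]] comp_null_left[OF \<theta>(1) D[OF tO]] by simp
      finally have df0: "?d f = null (?D (sus s)) (?D t)" .
      obtain \<epsilon> where \<epsilon>: "\<And>x. x \<in> Obj C \<Longrightarrow> is_iso C (sus (?D x)) x (\<epsilon> x)"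
        and nat: "\<And>x y f. \<guillemotleft>f : x \<rightarrow> y\<guillemotright> \<Longrightarrow> f \<cdot> \<epsilon> x = \<epsilon> y \<cdot> susm (?d f)"
        using nat_iso_idE[OF Susp_Desusp] by blast
      obtain \<delta> where \<delta>: "\<guillemotleft>\<epsilon> (sus s) : sus (?D (sus s)) \<rightarrow> sus s\<guillemotright>" "\<guillemotleft>\<delta> : sus s \<rightarrow> sus (?D (sus s))\<guillemotright>"
          "\<epsilon> (sus s) \<cdot> \<delta> = Ident C (sus s)"
        using \<epsilon>[OF sus_Obj[OF sO]] by (meson is_isoE)
      have \<epsilon>t: "\<guillemotleft>\<epsilon> t : sus (?D t) \<rightarrow> t\<guillemotright>" using \<epsilon>[OF tO] is_iso_iff by simp
      have "f \<cdot> \<epsilon> (sus s) = null (sus (?D (sus s))) t"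
        using nat[OF f] df0 D sO tO comp_null_right[OF \<epsilon>t] by (simp add: sus_Obj)
      then have "f \<cdot> (\<epsilon> (sus s) \<cdot> \<delta>) = null (sus s) t"
        using assoc[OF \<delta>(2,1) f] comp_null_left[OF \<delta>(2) tO] by simp
      then show ?thesis using \<delta>(3) f by simp
    qed
  qed
qed

end

theorem theoremA:
  fixes K :: "'k ring" and C :: "('o, 'k, 'm) cat"
    and Susp Desusp :: "('o, 'm) endofun"
    and Tri :: "('o \<times> 'o \<times> 'o \<times> 'm \<times> 'm \<times> 'm) set"
    and w :: int and S :: "'o set"
  assumes "triangulated_category K C Susp Desusp Tri"
    and "hom_finite K C"
    and "split_idempotents C"
    and "w \<ge> 2"
    and "orthogonal_collection C Susp Desusp w S"
  shows "proper_abelian_subcategory C Tri (extension_closure C Tri S) \<and>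
    (\<forall>x\<in>extension_closure C Tri S.
       has_finite_length (full_subcategory C (extension_closure C Tri S)) x) \<and>
    {x. is_simple (full_subcategory C (extension_closure C Tri S)) x} =
      {x. \<exists>s\<in>S. isomorphic C x s}"
proof -
  interpret orthogonal_bricks K C Susp Desusp Tri S
    using triangulated_category.orthogonal_bricks_if_orthogonal_collection[OF assms(1,4,5)] .
  show ?thesis
    unfolding extension_closure_eq
    using \<A>_proper_abelian \<A>_finite_length is_simple_if_isomorphic_brick isomorphic_brick_if_is_simple
    by blast
qed

end
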